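(* The following five equivalences of categories hold: (i) $\mathbf{sL\text{-}APPS}$ is equivalent to $\mathbf{sL\text{-}DOM}$; (ii) $\mathbf{L\text{-}APPS}$ is equivalent to $\mathbf{L\text{-}DOM}$; (iii) $\mathbf{bc\text{-}APPS}$ is equivalent to $\mathbf{bc\text{-}DOM}$; (iv) $\mathbf{TopsL\text{-}APPS}$ is equivalent to $\mathbf{AsL\text{-}DOM}$; (v) $\mathbf{TopL\text{-}APPS}$ is equivalent to $\mathbf{AL\text{-}DOM}$. Here $\mathbf{sL\text{-}APPS}$, $\mathbf{L\text{-}APPS}$, $\mathbf{bc\text{-}APPS}$, $\mathbf{TopsL\text{-}APPS}$, $\mathbf{TopL\text{-}APPS}$ are the categories whose objects are, respectively, sL-approximation spaces, L-approximation spaces, bc-approximation spaces, topological sL-approximation spaces, topological L-approximation spaces, and whose morphisms are CF-approximable relations; and $\mathbf{sL\text{-}DOM}$, $\mathbf{L\text{-}DOM}$, $\mathbf{bc\text{-}DOM}$, $\mathbf{AsL\text{-}DOM}$, $\mathbf{AL\text{-}DOM}$ are the categories whose objects are, respectively, sL-domains, L-domains, bc-domains, algebraic sL-domains, algebraic L-domains, and whose morphisms are Scott continuous mappings.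
   Context: Upper approximation: for a set $U$, a binary relation $R$ on $U$ and $A\subseteq U$, put $\overline R(A)=\{x\in U\mid \exists y\in A,\ xRy\}$. $K\subseteq_{fin}X$ means that $K$ is a finite (possibly empty) subset of $X$, and $\mathcal P_{fin}(U)$ is the set of all finite subsets of $U$. CF-approximation space: a triple $(U,R,\mathcal F)$ with $R$ a transitive relation on the set $U$ and $\emptyset\neq\mathcal F\subseteq\mathcal P_{fin}(U)$ such that for every $F\in\mathcal F$ and every $K\subseteq_{fin}\overline R(F)$ there is $G\in\mathcal F$ with $K\subseteq\overline R(G)$ and $G\subseteq\overline R(F)$. It is topological if $R$ is a preorder (reflexive and transitive). $\mathcal F^{\sharp}$ is the set of all unions of nonempty finite subfamilies of $\mathcal F$. For $M\in\mathcal F^{\sharp}\cup\{\emptyset\}$ and $F,G\in\mathcal F$ consider the conditions: (sL-1) $\overline R(M)\subseteq\overline R(G)\subseteq\overline R(F)$; (sL-2) for all $G'\in\mathcal F$, $\overline R(M)\subseteq\overline R(G')\subseteq\overline R(F)$ implies $\overline R(G)\subseteq\overline R(G')$; (sL-$2'$) for all $G'\in\mathcal F$, $\overline R(M)\subseteq\overline R(G')$ implies $\overline R(G)\subseteq\overline R(G')$. A CF-approximation space is: - an sL-approximation space if for all $M\in\mathcal F^{\sharp}$, $F\in\mathcal F$ with $M\subseteq\overline R(F)$ there is $G\in\mathcal F$ satisfying (sL-1) and (sL-2); - an L-approximation space if for all $M\in\mathcal F^{\sharp}\cup\{\emptyset\}$, $F\in\mathcal F$ with $M\subseteq\overline R(F)$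 there is $G\in\mathcal F$ satisfying (sL-1) and (sL-2); - a bc-approximation space if for all $M\in\mathcal F^{\sharp}\cup\{\emptyset\}$, $F\in\mathcal F$ with $M\subseteq\overline R(F)$ there is $G\in\mathcal F$ satisfying (sL-1) and (sL-$2'$). A topological sL- (resp. L-) approximation space is an sL- (resp. L-) approximation space that is topological. CF-approximable relation from $(U_1,R_1,\mathcal F_1)$ to $(U_2,R_2,\mathcal F_2)$: a relation $\Theta\subseteq\mathcal F_1\times\mathcal F_2$ such that (1) for all $F\in\mathcal F_1$ there is $G\in\mathcal F_2$ with $F\,\Theta\,G$; (2) if $F,F'\in\mathcal F_1$, $G\in\mathcal F_2$, $F\subseteq\overline{R_1}(F')$ and $F\,\Theta\,G$, then $F'\,\Theta\,G$; (3) if $F\in\mathcal F_1$, $G,G'\in\mathcal F_2$, $F\,\Theta\,G$ and $G'\subseteq\overline{R_2}(G)$, then $F\,\Theta\,G'$; (4) if $F\,\Theta\,G$, then there are $F'\in\mathcal F_1$, $G'\in\mathcal F_2$ with $F'\subseteq\overline{R_1}(F)$, $G\subseteq\overline{R_2}(G')$ and $F'\,\Theta\,G'$; (5) if $F\,\Theta\,G_1$ and $F\,\Theta\,G_2$, then there is $G_3\in\mathcal F_2$ with $G_1\cup G_2\subseteq\overline{R_2}(G_3)$ and $F\,\Theta\,G_3$. Composition of morphisms is composition of relations ($F\,(\Upsilon\circ\Theta)\,H$ iff there is $G$ with $F\,\Theta\,G$ and $G\,\Upsilon\,H$), and the identity on $(U,R,\mathcal F)$ is the relation $\{(F,G)\in\mathcal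 F\times\mathcal F\mid G\subseteq\overline R(F)\}$. Each of the categories of approximation spaces is a full subcategory of the category of CF-approximation spaces and CF-approximable relations. Domains: directed sets are nonempty; a dcpo is a poset in which every directed subset has a supremum. $x\ll y$ means that for every directed $D$ having a supremum with $\sup D\geqslant y$ there is $d\in D$ with $x\leqslant d$; $K(L)=\{x\in L\mid x\ll x\}$. A continuous domain is a dcpo in which, for every $x$, the set $\{y\mid y\ll x\}$ is directed with supremum $x$; an algebraic domain is a dcpo in which, for every $x$, the set ${\downarrow}x\cap K(L)$ is directed with supremum $x$, where ${\downarrow}x=\{y\mid y\leqslant x\}$. A sup-semilattice is a poset in which every pair of elements has a supremum. A continuous domain $L$ is an sL-domain (resp. L-domain) if every ${\downarrow}x$, with the inherited order, is a sup-semilattice (resp. complete lattice); it is a bc-domain if every subset with an upper bound has a supremum. An algebraic sL-domain (resp. algebraic L-domain) is an sL-domain (resp. L-domain) that is an algebraic domain. A map between dcpos is Scott continuous if it preserves suprema of directed subsets.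
   Formalization: Domains are required to be nonempty: the empty poset would meet the stated definitions but receives no map from a nonempty domain, while any two approximation spaces have a CF-approximable relation between them. As usual, the categories consist of small objects relative to a universe of sets. *)

theory Defs
  imports "HOL-Algebra.Complete_Lattice" "HOL-Library.FuncSet" "HOL-Library.Equipollence"
begin

section \<open>Categories\<close>

text \<open>A category is given by its objects and its hom-sets. Hom-sets are not required to be
  disjoint, so identities and composition carry the objects as arguments:
  \<open>compos C X Y Z g f\<close> is \<open>g \<circ> f\<close> for \<open>f : X \<rightarrow> Y\<close> and \<open>g : Y \<rightarrow> Z\<close>.\<close>

record ('o, 'm) cat =
  objs :: "'o set"
  homs :: "'o \<Rightarrow> 'o \<Rightarrow> 'm set"
  ident :: "'o \<Rightarrow> 'm"
  compos :: "'o \<Rightarrow> 'o \<Rightarrow> 'o \<Rightarrow> 'm \<Rightarrow> 'm \<Rightarrow> 'm"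

definition category :: "('o, 'm) cat \<Rightarrow> bool" where
  "category C \<longleftrightarrow>
     (\<forall>X\<in>objs C. ident C X \<in> homs C X X) \<and>
     (\<forall>X\<in>objs C. \<forall>Y\<in>objs C. \<forall>Z\<in>objs C. \<forall>f\<in>homs C X Y. \<forall>g\<in>homs C Y Z.
        compos C X Y Z g f \<in> homs C X Z) \<and>
     (\<forall>X\<in>objs C. \<forall>Y\<in>objs C. \<forall>f\<in>homs C X Y.
        compos C X X Y f (ident C X) = f \<and> compos C X Y Y (ident C Y) f = f) \<and>
     (\<forall>W\<in>objs C. \<forall>X\<in>objs C. \<forall>Y\<in>objs C. \<forall>Z\<in>objs C.
        \<forall>f\<in>homs C W X. \<forall>g\<in>homs C X Y. \<forall>h\<in>homs C Y Z.
        compos C W X Z (compos C X Y Z h g) f = compos C W Y Z h (compos C W X Y g f))"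

definition iso_arrow :: "('o, 'm) cat \<Rightarrow> 'o \<Rightarrow> 'o \<Rightarrow> 'm \<Rightarrow> bool" where
  "iso_arrow C X Y f \<longleftrightarrow> f \<in> homs C X Y \<and>
     (\<exists>g\<in>homs C Y X. compos C X Y X g f = ident C X \<and> compos C Y X Y f g = ident C Y)"

text \<open>A functor consists of an object map \<open>Fo\<close> and an arrow map \<open>Fa\<close>, where \<open>Fa X Y\<close> acts on
  the arrows from \<open>X\<close> to \<open>Y\<close>.\<close>

definition is_functor ::
  "('o, 'm) cat \<Rightarrow> ('p, 'n) cat \<Rightarrow> ('o \<Rightarrow> 'p) \<Rightarrow> ('o \<Rightarrow> 'o \<Rightarrow> 'm \<Rightarrow> 'n) \<Rightarrow> bool" where
  "is_functor C D Fo Fa \<longleftrightarrow>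
     (\<forall>X\<in>objs C. Fo X \<in> objs D) \<and>
     (\<forall>X\<in>objs C. \<forall>Y\<in>objs C. \<forall>f\<in>homs C X Y. Fa X Y f \<in> homs D (Fo X) (Fo Y)) \<and>
     (\<forall>X\<in>objs C. Fa X X (ident C X) = ident D (Fo X)) \<and>
     (\<forall>X\<in>objs C. \<forall>Y\<in>objs C. \<forall>Z\<in>objs C. \<forall>f\<in>homs C X Y. \<forall>g\<in>homs C Y Z.
        Fa X Z (compos C X Y Z g f) = compos D (Fo X) (Fo Y) (Fo Z) (Fa Y Z g) (Fa X Y f))"

definition naturally_isomorphic ::
  "('o, 'm) cat \<Rightarrow> ('p, 'n) cat \<Rightarrow> ('o \<Rightarrow> 'p) \<Rightarrow> ('o \<Rightarrow> 'o \<Rightarrow> 'm \<Rightarrow> 'n)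
     \<Rightarrow> ('o \<Rightarrow> 'p) \<Rightarrow> ('o \<Rightarrow> 'o \<Rightarrow> 'm \<Rightarrow> 'n) \<Rightarrow> bool" where
  "naturally_isomorphic C D Fo Fa Go Ga \<longleftrightarrow> (\<exists>\<eta>.
     (\<forall>X\<in>objs C. iso_arrow D (Fo X) (Go X) (\<eta> X)) \<and>
     (\<forall>X\<in>objs C. \<forall>Y\<in>objs C. \<forall>f\<in>homs C X Y.
        compos D (Fo X) (Fo Y) (Go Y) (\<eta> Y) (Fa X Y f) =
        compos D (Fo X) (Go X) (Go Y) (Ga X Y f) (\<eta> X)))"

definition equivalent_categories :: "('o, 'm) cat \<Rightarrow> ('p, 'n) cat \<Rightarrow> bool" where
  "equivalent_categories C D \<longleftrightarrow> category C \<and> category D \<and> (\<exists>Fo Fa Go Ga.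
     is_functor C D Fo Fa \<and> is_functor D C Go Ga \<and>
     naturally_isomorphic C C (\<lambda>X. Go (Fo X)) (\<lambda>X Y f. Ga (Fo X) (Fo Y) (Fa X Y f))
       (\<lambda>X. X) (\<lambda>X Y f. f) \<and>
     naturally_isomorphic D D (\<lambda>X. Fo (Go X)) (\<lambda>X Y f. Fa (Go X) (Go Y) (Ga X Y f))
       (\<lambda>X. X) (\<lambda>X Y f. f))"

section \<open>Size\<close>

text \<open>There is no type of all sets, so the objects of the categories below have their carriers in
  a fixed but arbitrary type \<open>'u\<close> and satisfying a smallness predicate. Neither direction of the
  equivalence preserves an arbitrary cardinality bound: the domain of a space lives on subsets of
  the points of the space. The predicate \<open>power_step s t\<close> says that power sets of \<open>s\<close>-small sets,
  and everything that embeds into them, are \<open>t\<close>-small and fit into \<open>'u\<close>. A notion of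
  smallness closed under this step is a universe, for instance the sets of
  size below a strong limit cardinal such as that of a Grothendieck universe.\<close>

definition power_step :: "('u set \<Rightarrow> bool) \<Rightarrow> ('u set \<Rightarrow> bool) \<Rightarrow> bool" where
  "power_step s t \<longleftrightarrow>
     (\<forall>A. s A \<longrightarrow> Pow A \<lesssim> (UNIV :: 'u set) \<and> (\<forall>B :: 'u set. B \<lesssim> Pow A \<longrightarrow> t B))"

definition universe :: "('u set \<Rightarrow> bool) \<Rightarrow> bool" where
  "universe small \<longleftrightarrow> power_step small small"

text \<open>The existence of a universe containing an infinite set is not provable in HOL. The following
  version of equivalence does not need one. It concerns size-indexed families of categories and
  asks for a single pair of functors, with \<open>G \<circ> F\<close> and \<open>F \<circ> G\<close> naturally isomorphic to the
  inclusions of the categories into those of larger size. For a universe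
  \<open>s = t = u\<close> it specializes to an equivalence of \<open>C s\<close> and \<open>D s\<close>.\<close>

definition equivalent_across_sizes ::
  "(('u set \<Rightarrow> bool) \<Rightarrow> ('o, 'm) cat) \<Rightarrow> (('u set \<Rightarrow> bool) \<Rightarrow> ('p, 'n) cat) \<Rightarrow> bool" where
  "equivalent_across_sizes C D \<longleftrightarrow>
     (\<forall>s. category (C s) \<and> category (D s)) \<and>
     (\<exists>Fo Fa Go Ga. \<forall>s t u. power_step s t \<and> power_step t u \<longrightarrow>
        is_functor (C s) (D t) Fo Fa \<and> is_functor (D s) (C t) Go Ga \<and>
        naturally_isomorphic (C s) (C u)
          (\<lambda>X. Go (Fo X)) (\<lambda>X Y f. Ga (Fo X) (Fo Y) (Fa X Y f)) (\<lambda>X. X) (\<lambda>X Y f. f) \<and>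
        naturally_isomorphic (D s) (D u)
          (\<lambda>X. Fo (Go X)) (\<lambda>X Y f. Fa (Go X) (Go Y) (Ga X Y f)) (\<lambda>X. X) (\<lambda>X Y f. f))"

section \<open>Approximation spaces\<close>

record 'a space =
  points :: "'a set"
  rel :: "('a \<times> 'a) set"
  fam :: "'a set set"

definition upper_approx :: "'a space \<Rightarrow> 'a set \<Rightarrow> 'a set" where
  "upper_approx X A = {x \<in> points X. \<exists>y\<in>A. (x, y) \<in> rel X}"

definition CF_space :: "'a space \<Rightarrow> bool" where
  "CF_space X \<longleftrightarrow>
     rel X \<subseteq> points X \<times> points X \<and> trans (rel X) \<and>
     fam X \<noteq> {} \<and> (\<forall>F\<in>fam X. finite F \<and> F \<subseteq> points X) \<and>
     (\<forall>F\<in>fam X. \<forall>K. finite K \<and> K \<subseteq> upper_approx X F \<longrightarrow>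
        (\<exists>G\<in>fam X. K \<subseteq> upper_approx X G \<and> G \<subseteq> upper_approx X F))"

definition topological :: "'a space \<Rightarrow> bool" where
  "topological X \<longleftrightarrow> preorder_on (points X) (rel X)"

definition fam_sharp :: "'a space \<Rightarrow> 'a set set" where
  "fam_sharp X = {\<Union>S | S. S \<subseteq> fam X \<and> finite S \<and> S \<noteq> {}}"

definition sL1 :: "'a space \<Rightarrow> 'a set \<Rightarrow> 'a set \<Rightarrow> 'a set \<Rightarrow> bool" where
  "sL1 X M F G \<longleftrightarrow>
     upper_approx X M \<subseteq> upper_approx X G \<and> upper_approx X G \<subseteq> upper_approx X F"

definition sL2 :: "'a space \<Rightarrow> 'a set \<Rightarrow> 'a set \<Rightarrow> 'a set \<Rightarrow> bool" where
  "sL2 X M F G \<longleftrightarrow> (\<forall>G'\<in>fam X.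
     upper_approx X M \<subseteq> upper_approx X G' \<and> upper_approx X G' \<subseteq> upper_approx X F
       \<longrightarrow> upper_approx X G \<subseteq> upper_approx X G')"

definition sL2' :: "'a space \<Rightarrow> 'a set \<Rightarrow> 'a set \<Rightarrow> bool" where
  "sL2' X M G \<longleftrightarrow> (\<forall>G'\<in>fam X.
     upper_approx X M \<subseteq> upper_approx X G' \<longrightarrow> upper_approx X G \<subseteq> upper_approx X G')"

definition sL_space :: "'a space \<Rightarrow> bool" where
  "sL_space X \<longleftrightarrow> CF_space X \<and>
     (\<forall>M\<in>fam_sharp X. \<forall>F\<in>fam X. M \<subseteq> upper_approx X F \<longrightarrow>
        (\<exists>G\<in>fam X. sL1 X M F G \<and> sL2 X M F G))"

definition L_space :: "'a space \<Rightarrow> bool" where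
  "L_space X \<longleftrightarrow> CF_space X \<and>
     (\<forall>M\<in>fam_sharp X \<union> {{}}. \<forall>F\<in>fam X. M \<subseteq> upper_approx X F \<longrightarrow>
        (\<exists>G\<in>fam X. sL1 X M F G \<and> sL2 X M F G))"

definition bc_space :: "'a space \<Rightarrow> bool" where
  "bc_space X \<longleftrightarrow> CF_space X \<and>
     (\<forall>M\<in>fam_sharp X \<union> {{}}. \<forall>F\<in>fam X. M \<subseteq> upper_approx X F \<longrightarrow>
        (\<exists>G\<in>fam X. sL1 X M F G \<and> sL2' X M G))"

definition CF_approximable :: "'a space \<Rightarrow> 'b space \<Rightarrow> ('a set \<times> 'b set) set \<Rightarrow> bool" where
  "CF_approximable X Y \<Theta> \<longleftrightarrow>
     \<Theta> \<subseteq> fam X \<times> fam Y \<and>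
     (\<forall>F\<in>fam X. \<exists>G\<in>fam Y. (F, G) \<in> \<Theta>) \<and>
     (\<forall>F\<in>fam X. \<forall>F'\<in>fam X. \<forall>G\<in>fam Y.
        F \<subseteq> upper_approx X F' \<and> (F, G) \<in> \<Theta> \<longrightarrow> (F', G) \<in> \<Theta>) \<and>
     (\<forall>F\<in>fam X. \<forall>G\<in>fam Y. \<forall>G'\<in>fam Y.
        (F, G) \<in> \<Theta> \<and> G' \<subseteq> upper_approx Y G \<longrightarrow> (F, G') \<in> \<Theta>) \<and>
     (\<forall>F G. (F, G) \<in> \<Theta> \<longrightarrow> (\<exists>F'\<in>fam X. \<exists>G'\<in>fam Y.
        F' \<subseteq> upper_approx X F \<and> G \<subseteq> upper_approx Y G' \<and> (F', G') \<in> \<Theta>)) \<and>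
     (\<forall>F G1 G2. (F, G1) \<in> \<Theta> \<and> (F, G2) \<in> \<Theta> \<longrightarrow>
        (\<exists>G3\<in>fam Y. G1 \<union> G2 \<subseteq> upper_approx Y G3 \<and> (F, G3) \<in> \<Theta>))"

text \<open>The operator \<open>O\<close> composes relations from left to right.\<close>

definition APPS ::
  "('a space \<Rightarrow> bool) \<Rightarrow> ('a set \<Rightarrow> bool) \<Rightarrow> ('a space, ('a set \<times> 'a set) set) cat" where
  "APPS P small =
     \<lparr>objs = {X. P X \<and> small (points X)},
      homs = (\<lambda>X Y. {\<Theta>. CF_approximable X Y \<Theta>}),
      ident = (\<lambda>X. {(F, G). F \<in> fam X \<and> G \<in> fam X \<and> G \<subseteq> upper_approx X F}),
      compos = (\<lambda>X Y Z \<Upsilon> \<Theta>. \<Theta> O \<Upsilon>)\<rparr>"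

abbreviation "sL_APPS \<equiv> APPS sL_space"
abbreviation "L_APPS \<equiv> APPS L_space"
abbreviation "bc_APPS \<equiv> APPS bc_space"
abbreviation "TopsL_APPS \<equiv> APPS (\<lambda>X. sL_space X \<and> topological X)"
abbreviation "TopL_APPS \<equiv> APPS (\<lambda>X. L_space X \<and> topological X)"

section \<open>Domains\<close>

definition directed :: "'a gorder \<Rightarrow> 'a set \<Rightarrow> bool" where
  "directed L D \<longleftrightarrow> D \<subseteq> carrier L \<and> D \<noteq> {} \<and>
     (\<forall>x\<in>D. \<forall>y\<in>D. \<exists>z\<in>D. x \<sqsubseteq>\<^bsub>L\<^esub> z \<and> y \<sqsubseteq>\<^bsub>L\<^esub> z)"

text \<open>Posets are nonempty. If the empty poset counted as a domain, it would satisfy the domain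
  axioms below vacuously, and it would admit no map from a nonempty domain. But there is a
  CF-approximable relation between any two spaces, because \<open>fam\<close> is never empty.\<close>

definition dcpo :: "'a gorder \<Rightarrow> bool" where
  "dcpo L \<longleftrightarrow> partial_order L \<and> carrier L \<noteq> {} \<and>
     (\<forall>D. directed L D \<longrightarrow> (\<exists>s. is_lub L s D))"

definition way_below :: "'a gorder \<Rightarrow> 'a \<Rightarrow> 'a \<Rightarrow> bool" where
  "way_below L x y \<longleftrightarrow> x \<in> carrier L \<and> y \<in> carrier L \<and>
     (\<forall>D s. directed L D \<and> is_lub L s D \<and> y \<sqsubseteq>\<^bsub>L\<^esub> s \<longrightarrow> (\<exists>d\<in>D. x \<sqsubseteq>\<^bsub>L\<^esub> d))"

definition compacts :: "'a gorder \<Rightarrow> 'a set" where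
  "compacts L = {x \<in> carrier L. way_below L x x}"

definition down :: "'a gorder \<Rightarrow> 'a \<Rightarrow> 'a set" where
  "down L x = {y \<in> carrier L. y \<sqsubseteq>\<^bsub>L\<^esub> x}"

definition continuous_domain :: "'a gorder \<Rightarrow> bool" where
  "continuous_domain L \<longleftrightarrow> dcpo L \<and>
     (\<forall>x\<in>carrier L. directed L {y. way_below L y x} \<and> is_lub L x {y. way_below L y x})"

definition algebraic_domain :: "'a gorder \<Rightarrow> bool" where
  "algebraic_domain L \<longleftrightarrow> dcpo L \<and>
     (\<forall>x\<in>carrier L. directed L (down L x \<inter> compacts L) \<and> is_lub L x (down L x \<inter> compacts L))"

definition sL_domain :: "'a gorder \<Rightarrow> bool" where
  "sL_domain L \<longleftrightarrow> continuous_domain L \<and>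
     (\<forall>x\<in>carrier L. upper_semilattice (L\<lparr>carrier := down L x\<rparr>))"

definition L_domain :: "'a gorder \<Rightarrow> bool" where
  "L_domain L \<longleftrightarrow> continuous_domain L \<and>
     (\<forall>x\<in>carrier L. complete_lattice (L\<lparr>carrier := down L x\<rparr>))"

definition bc_domain :: "'a gorder \<Rightarrow> bool" where
  "bc_domain L \<longleftrightarrow> continuous_domain L \<and>
     (\<forall>A. A \<subseteq> carrier L \<and> Upper L A \<noteq> {} \<longrightarrow> (\<exists>s. is_lub L s A))"

definition scott_continuous :: "'a gorder \<Rightarrow> 'b gorder \<Rightarrow> ('a \<Rightarrow> 'b) \<Rightarrow> bool" where
  "scott_continuous L M f \<longleftrightarrow> f \<in> carrier L \<rightarrow> carrier M \<and>
     (\<forall>D s. directed L D \<and> is_lub L s D \<longrightarrow> is_lub M (f s) (f ` D))"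

text \<open>Maps are extensional (\<open>undefined\<close> off the carrier), so that equality of arrows is equality
  of maps on the carrier.\<close>

definition DOM ::
  "('a gorder \<Rightarrow> bool) \<Rightarrow> ('a set \<Rightarrow> bool) \<Rightarrow> ('a gorder, 'a \<Rightarrow> 'a) cat" where
  "DOM P small =
     \<lparr>objs = {L. P L \<and> small (carrier L)},
      homs = (\<lambda>L M. {f \<in> extensional (carrier L). scott_continuous L M f}),
      ident = (\<lambda>L. restrict (\<lambda>x. x) (carrier L)),
      compos = (\<lambda>L M N g f. compose (carrier L) g f)\<rparr>"

abbreviation "sL_DOM \<equiv> DOM sL_domain"
abbreviation "L_DOM \<equiv> DOM L_domain"
abbreviation "bc_DOM \<equiv> DOM bc_domain"
abbreviation "AsL_DOM \<equiv> DOM (\<lambda>L. sL_domain L \<and> algebraic_domain L)"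
abbreviation "AL_DOM \<equiv> DOM (\<lambda>L. L_domain L \<and> algebraic_domain L)"

end

theory Submission
  imports Defs
begin

text \<open>The members of \<open>\<F>\<close>, related by \<open>F \<subseteq> upper_approx X G\<close>, form an abstract basis, and
  CF-approximable relations are exactly the approximable relations of abstract bases. The domain of
  a space is its rounded ideal completion, in which a rounded ideal may be replaced by its union and
  hence encoded in the type of points. Conversely a domain \<open>L\<close> with basis \<open>B\<close> (all of \<open>L\<close>, or the
  compact elements if \<open>L\<close> is algebraic) gives the space of singletons of \<open>B\<close> with the way-below
  relation, and \<open>L\<close> itself is an ideal completion of that space. For arbitrary ideal completions
  \<open>L\<close> of \<open>X\<close> and \<open>M\<close> of \<open>Y\<close>, relations from \<open>X\<close> to \<open>Y\<close> correspond to Scott continuous maps from \<open>L\<close>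
  to \<open>M\<close>, compatibly with composition. Both functors and both natural isomorphisms are
  instances of this correspondence: the latter come from identities, since \<open>X\<close> and the space of
  \<open>L\<close> share the ideal completion \<open>L\<close>. The lattice conditions transfer because relative joins in
  the space generate joins of ideals, and joins of finitely many compact elements in a principal
  ideal are compact.\<close>

section \<open>Posets and Scott continuous maps\<close>

text \<open>The obstacle is that in the sL- and L-cases a join exists only relative to an upper
  bound, and different upper bounds may give different joins. What saves the construction is that
  the bounds in use can always be compared. If \<open>H\<close> lies in the approximation of
  \<open>K\<close>, then the joins of the same set relative to \<open>H\<close> and to
  \<open>K\<close> have the same upper approximation; and any two members of a rounded ideal lie in
  the approximation of a third one. So inside one ideal all relative joins are coherent. The same
  trick on the domain side moves joins of compact elements between two principal ideals through a
  third that contains both joins. Only the bc-condition has a minimality clause free of a bound, and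
  it gives joins that are least among all upper bounds.

  Taking the compact elements as basis in the algebraic case makes the way-below relation reflexive
  on the basis, which is what \<open>topological\<close> demands. Relations are never compared pair
  by pair: each is determined by its images of rounded ideals, so equations between relations become
  equations between the maps that they induce.\<close>

lemma is_lub_iff:
  assumes "A \<subseteq> carrier L"
  shows "is_lub L s A \<longleftrightarrow> s \<in> carrier L \<and> (\<forall>a\<in>A. a \<sqsubseteq>\<^bsub>L\<^esub> s) \<and>
           (\<forall>u\<in>carrier L. (\<forall>a\<in>A. a \<sqsubseteq>\<^bsub>L\<^esub> u) \<longrightarrow> s \<sqsubseteq>\<^bsub>L\<^esub> u)"
  using assms unfolding least_def Upper_def by blast

lemma is_lub_down_iff:
  assumes "A \<subseteq> down L x"
  shows "is_lub (L\<lparr>carrier := down L x\<rparr>) s A \<longleftrightarrow>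
           s \<in> carrier L \<and> s \<sqsubseteq>\<^bsub>L\<^esub> x \<and> (\<forall>a\<in>A. a \<sqsubseteq>\<^bsub>L\<^esub> s) \<and>
           (\<forall>u\<in>carrier L. u \<sqsubseteq>\<^bsub>L\<^esub> x \<longrightarrow> (\<forall>a\<in>A. a \<sqsubseteq>\<^bsub>L\<^esub> u) \<longrightarrow> s \<sqsubseteq>\<^bsub>L\<^esub> u)"
  using assms by (subst is_lub_iff) (auto simp: down_def)

lemma partial_order_down:
  assumes "partial_order L"
  shows "partial_order (L\<lparr>carrier := down L x\<rparr>)"
proof -
  interpret partial_order L by fact
  show ?thesis
    by unfold_locales (auto simp: down_def eq_is_equal intro: le_trans)
qed

text \<open>An infimum is the supremum of the set of lower bounds, so suprema of all subsets are
  enough.\<close>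

lemma (in partial_order) complete_latticeI_sup:
  assumes sup: "\<And>A. A \<subseteq> carrier L \<Longrightarrow> \<exists>s. is_lub L s A"
  shows "complete_lattice L"
proof (rule complete_latticeI)
  fix A assume A: "A \<subseteq> carrier L"
  have "Lower L A \<subseteq> carrier L" by (auto simp: Lower_def)
  moreover from sup[OF this] obtain i where "is_lub L i (Lower L A)" ..
  ultimately have "greatest L i (Lower L A)"
    using A by (subst (asm) is_lub_iff) (auto simp: greatest_def Lower_def)
  then show "\<exists>i. greatest L i (Lower L A)" ..
qed (rule sup)

lemma directed_finite_bound:
  assumes "partial_order L" "directed L D" "finite S" "S \<subseteq> D"
  shows "\<exists>d\<in>D. \<forall>x\<in>S. x \<sqsubseteq>\<^bsub>L\<^esub> d"
  using assms(3,4)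
proof (induction S rule: finite_induct)
  case empty
  then show ?case using assms(2) by (auto simp: directed_def)
next
  case (insert x S)
  interpret partial_order L by fact
  from insert obtain d where d: "d \<in> D" "\<forall>x\<in>S. x \<sqsubseteq>\<^bsub>L\<^esub> d" by auto
  with insert assms(2) obtain e where "e \<in> D" "x \<sqsubseteq>\<^bsub>L\<^esub> e" "d \<sqsubseteq>\<^bsub>L\<^esub> e"
    unfolding directed_def by blast
  moreover have D: "D \<subseteq> carrier L" using assms(2) by (simp add: directed_def)
  ultimately have "y \<sqsubseteq>\<^bsub>L\<^esub> e" if "y \<in> S" for y
    using that d insert.prems le_trans[of y d e] by blast
  then show ?case using \<open>x \<sqsubseteq>\<^bsub>L\<^esub> e\<close> \<open>e \<in> D\<close> by blast
qed

text \<open>For comparable elements the pair is itself a directed set, with the larger one as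
  supremum, and that supremum is preserved.\<close>

lemma scott_continuous_mono:
  assumes "partial_order L" "scott_continuous L M f"
    and "x \<in> carrier L" "y \<in> carrier L" "x \<sqsubseteq>\<^bsub>L\<^esub> y"
  shows "f x \<sqsubseteq>\<^bsub>M\<^esub> f y"
proof -
  interpret partial_order L by fact
  have "directed L {x, y}" using assms(3-5) by (auto simp: directed_def)
  moreover have "is_lub L y {x, y}" using assms(3-5) by (subst is_lub_iff) auto
  ultimately have "is_lub M (f y) (f ` {x, y})"
    using assms(2) unfolding scott_continuous_def by blast
  moreover have "f ` {x, y} \<subseteq> carrier M"
    using assms(2-4) by (auto simp: scott_continuous_def)
  ultimately show ?thesis by (subst (asm) is_lub_iff) auto
qed

lemma directed_image:
  assumes "directed L D" "f \<in> carrier L \<rightarrow> carrier M"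
    and "\<And>x y. \<lbrakk>x \<in> carrier L; y \<in> carrier L; x \<sqsubseteq>\<^bsub>L\<^esub> y\<rbrakk> \<Longrightarrow> f x \<sqsubseteq>\<^bsub>M\<^esub> f y"
  shows "directed M (f ` D)"
proof -
  have D: "D \<subseteq> carrier L" using assms(1) by (simp add: directed_def)
  show ?thesis
    unfolding directed_def
  proof (intro conjI ballI)
    show "f ` D \<subseteq> carrier M" using D assms(2) by auto
    show "f ` D \<noteq> {}" using assms(1) by (simp add: directed_def)
    fix u v assume "u \<in> f ` D" "v \<in> f ` D"
    then obtain x y where xy: "x \<in> D" "y \<in> D" "u = f x" "v = f y" by blast
    with assms(1) obtain z where "z \<in> D" "x \<sqsubseteq>\<^bsub>L\<^esub> z" "y \<sqsubseteq>\<^bsub>L\<^esub> z"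
      unfolding directed_def by blast
    with xy D assms(3) show "\<exists>w\<in>f ` D. u \<sqsubseteq>\<^bsub>M\<^esub> w \<and> v \<sqsubseteq>\<^bsub>M\<^esub> w" by blast
  qed
qed

section \<open>Bases of continuous domains\<close>

text \<open>One notion for the two bases in use: \<open>carrier L\<close> is a basis of a continuous
  domain, \<open>compacts L\<close> of an algebraic one.\<close>

definition is_basis :: "'a gorder \<Rightarrow> 'a set \<Rightarrow> bool" where
  "is_basis L B \<longleftrightarrow> B \<subseteq> carrier L \<and>
     (\<forall>x\<in>carrier L. directed L {b \<in> B. way_below L b x} \<and> is_lub L x {b \<in> B. way_below L b x})"

locale based_domain =
  fixes L :: "'a gorder" (structure) and B :: "'a set"
  assumes dcpo: "dcpo L" and basis: "is_basis L B"
begin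

sublocale partial_order L
  using dcpo by (simp add: dcpo_def)

abbreviation wb (infix "\<lless>" 50) where "x \<lless> y \<equiv> way_below L x y"

lemma B_carrier: "B \<subseteq> carrier L"
  using basis by (simp add: is_basis_def)

lemma wb_carrier: "x \<lless> y \<Longrightarrow> x \<in> carrier L" "x \<lless> y \<Longrightarrow> y \<in> carrier L"
  by (simp_all add: way_below_def)

lemma wb_le:
  assumes "x \<lless> y" shows "x \<sqsubseteq> y"
proof -
  have "y \<in> carrier L" using assms by (rule wb_carrier)
  then have "directed L {y}" "is_lub L y {y}" "y \<sqsubseteq> y"
    by (auto simp: directed_def is_lub_iff)
  with assms show ?thesis unfolding way_below_def by blast
qed

lemma wb_le_trans:
  assumes "x \<lless> y" "y \<sqsubseteq> z" "z \<in> carrier L" shows "x \<lless> z"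
  unfolding way_below_def
proof (intro conjI allI impI)
  fix D s assume D: "directed L D \<and> is_lub L s D \<and> z \<sqsubseteq> s"
  then have "s \<in> carrier L" by (auto simp: least_def Upper_def)
  then have "y \<sqsubseteq> s" using assms D le_trans[of y z s] wb_carrier(2)[of x y] by blast
  then show "\<exists>d\<in>D. x \<sqsubseteq> d" using D assms(1) unfolding way_below_def by blast
qed (use assms wb_carrier in auto)

lemma le_wb_trans:
  assumes "x \<sqsubseteq> y" "y \<lless> z" "x \<in> carrier L" shows "x \<lless> z"
  unfolding way_below_def
proof (intro conjI allI impI)
  fix D s assume D: "directed L D \<and> is_lub L s D \<and> z \<sqsubseteq> s"
  with assms(2) obtain d where "d \<in> D" "y \<sqsubseteq> d" unfolding way_below_def by blast
  moreover from this D have "d \<in> carrier L" by (auto simp: directed_def)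
  ultimately show "\<exists>d\<in>D. x \<sqsubseteq> d" using assms(1,3) le_trans[of x y d] wb_carrier(1)[OF assms(2)] by blast
qed (use assms wb_carrier in auto)

lemma wb_trans: "\<lbrakk>x \<lless> y; y \<lless> z\<rbrakk> \<Longrightarrow> x \<lless> z"
  by (meson le_wb_trans wb_carrier(1) wb_le)

lemma basis_directed: "x \<in> carrier L \<Longrightarrow> directed L {b \<in> B. b \<lless> x}"
  and basis_lub: "x \<in> carrier L \<Longrightarrow> is_lub L x {b \<in> B. b \<lless> x}"
  using basis by (auto simp: is_basis_def)

lemma le_iff_basis:
  assumes "x \<in> carrier L" "y \<in> carrier L"
  shows "x \<sqsubseteq> y \<longleftrightarrow> (\<forall>b\<in>B. b \<lless> x \<longrightarrow> b \<lless> y)"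
proof
  assume "\<forall>b\<in>B. b \<lless> x \<longrightarrow> b \<lless> y"
  then have "\<forall>b\<in>{b \<in> B. b \<lless> x}. b \<sqsubseteq> y" by (auto intro: wb_le)
  moreover have "{b \<in> B. b \<lless> x} \<subseteq> carrier L" using B_carrier by blast
  ultimately show "x \<sqsubseteq> y" using basis_lub[OF assms(1)] assms(2) by (auto simp: is_lub_iff)
qed (use assms wb_le_trans[of _ x y] in blast)

text \<open>The basis elements that reach \<open>z\<close> by two way-below steps still form a
  directed set with supremum \<open>z\<close>. Applying \<open>x \<lless> z\<close> to this set puts
  \<open>x\<close> below such an element, and its intermediate step is the interpolant.\<close>

lemma interpolation1:
  assumes "x \<lless> z"
  shows "\<exists>b\<in>B. x \<lless> b \<and> b \<lless> z"
proof -
  let ?D = "{a \<in> B. \<exists>b\<in>B. a \<lless> b \<and> b \<lless> z}"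
  have z: "z \<in> carrier L" using assms by (rule wb_carrier)
  have sub: "?D \<subseteq> carrier L" using B_carrier by blast
  have "directed L ?D"
    unfolding directed_def
  proof (intro conjI ballI)
    show "?D \<subseteq> carrier L" by fact
    obtain b where "b \<in> B" "b \<lless> z" using basis_directed[OF z] by (auto simp: directed_def)
    moreover from this obtain a where "a \<in> B" "a \<lless> b"
      using basis_directed[of b] B_carrier by (auto simp: directed_def)
    ultimately show "?D \<noteq> {}" by blast
    fix a1 a2 assume "a1 \<in> ?D" "a2 \<in> ?D"
    then obtain b1 b2 where b: "a1 \<in> B" "b1 \<in> B" "a1 \<lless> b1" "b1 \<lless> z"
      "a2 \<in> B" "b2 \<in> B" "a2 \<lless> b2" "b2 \<lless> z" by blast
    then obtain b3 where b3: "b3 \<in> B" "b3 \<lless> z" "b1 \<sqsubseteq> b3" "b2 \<sqsubseteq> b3"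
      using basis_directed[OF z] unfolding directed_def by blast
    then have "a1 \<lless> b3" "a2 \<lless> b3" using b wb_le_trans[of _ _ b3] B_carrier by blast+
    with b obtain a3 where "a3 \<in> B" "a3 \<lless> b3" "a1 \<sqsubseteq> a3" "a2 \<sqsubseteq> a3"
      using basis_directed[of b3] wb_carrier[of a1 b3] unfolding directed_def by blast
    with b3 show "\<exists>a\<in>?D. a1 \<sqsubseteq> a \<and> a2 \<sqsubseteq> a" by blast
  qed
  moreover have "is_lub L z ?D"
    unfolding is_lub_iff[OF sub]
  proof (intro conjI ballI impI z)
    show "a \<sqsubseteq> z" if "a \<in> ?D" for a using that using wb_le wb_trans[of a _ z] by blast
    fix u assume u: "u \<in> carrier L" "\<forall>a\<in>?D. a \<sqsubseteq> u"
    have "b \<sqsubseteq> u" if "b \<in> B" "b \<lless> z" for b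
    proof -
      have sub: "{a \<in> B. a \<lless> b} \<subseteq> carrier L" using B_carrier by blast
      show ?thesis
        using basis_lub[of b] that u B_carrier unfolding is_lub_iff[OF sub] by blast
    qed
    moreover have sub: "{b \<in> B. b \<lless> z} \<subseteq> carrier L" using B_carrier by blast
    ultimately show "z \<sqsubseteq> u" using basis_lub[OF z] u unfolding is_lub_iff[OF sub] by blast
  qed
  moreover have "z \<sqsubseteq> z" using z by simp
  ultimately obtain a b where "a \<lless> b" "b \<in> B" "b \<lless> z" "x \<sqsubseteq> a"
    using assms unfolding way_below_def by blast
  then show ?thesis using le_wb_trans[of x a b] wb_carrier(1)[OF assms] by blast
qed

text \<open>Each \<open>k\<close> gets its own interpolant; these finitely many are bounded by one
  element of the directed set of basis elements way below \<open>x\<close>.\<close>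

lemma interpolation:
  assumes "finite K" "x \<in> carrier L" "\<And>k. k \<in> K \<Longrightarrow> k \<lless> x"
  shows "\<exists>b\<in>B. b \<lless> x \<and> (\<forall>k\<in>K. k \<lless> b)"
proof -
  from assms(3) have "\<forall>k\<in>K. \<exists>c. c \<in> B \<and> k \<lless> c \<and> c \<lless> x" using interpolation1 by blast
  then obtain c where c: "\<forall>k\<in>K. c k \<in> B \<and> k \<lless> c k \<and> c k \<lless> x" by (rule bchoice[THEN exE])
  then have "c ` K \<subseteq> {b \<in> B. b \<lless> x}" by blast
  from directed_finite_bound[OF partial_order_axioms basis_directed[OF assms(2)] _ this] assms(1)
  obtain b where "b \<in> B" "b \<lless> x" "\<forall>k\<in>K. c k \<sqsubseteq> b" by auto
  moreover from this have "k \<lless> b" if "k \<in> K" for k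
    using that c B_carrier wb_le_trans[of k "c k" b] by blast
  ultimately show ?thesis by blast
qed

end

lemma continuous_domain_based:
  assumes "continuous_domain L"
  shows "based_domain L (carrier L)"
proof
  have "{b \<in> carrier L. way_below L b x} = {b. way_below L b x}" for x
    by (auto simp: way_below_def)
  then show "is_basis L (carrier L)"
    using assms by (simp add: continuous_domain_def is_basis_def)
  show "dcpo L"
    using assms by (simp add: continuous_domain_def)
qed

text \<open>For compact \<open>b\<close>, being way below \<open>x\<close> is the same as being
  below \<open>x\<close>, so the directed sets in the two definitions coincide.\<close>

lemma algebraic_domain_based:
  assumes "continuous_domain L" "algebraic_domain L"
  shows "based_domain L (compacts L)"
proof
  interpret based_domain L "carrier L" using assms(1) by (rule continuous_domain_based)
  show "dcpo L" by (rule dcpo)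
  have "{b \<in> compacts L. way_below L b x} = down L x \<inter> compacts L" if "x \<in> carrier L" for x
  proof -
    have "way_below L b x \<longleftrightarrow> b \<sqsubseteq>\<^bsub>L\<^esub> x" if "b \<in> compacts L" for b
      using that \<open>x \<in> carrier L\<close> wb_le[of b x] wb_le_trans[of b b x]
      by (auto simp: compacts_def)
    then show ?thesis by (auto simp: compacts_def down_def)
  qed
  moreover have "compacts L \<subseteq> carrier L" by (auto simp: compacts_def)
  ultimately show "is_basis L (compacts L)"
    using assms(2) by (simp add: algebraic_domain_def is_basis_def)
qed

section \<open>Rounded ideals of an approximation space\<close>

text \<open>The clause on finite \<open>S\<close> packs three properties: \<open>S = {}\<close>
  gives nonemptiness, singletons give roundedness, pairs give directedness. The order between
  members, \<open>N \<subseteq> upper_approx X F\<close>, is transitive but need not be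
  reflexive.\<close>

definition rounded_ideals :: "'a space \<Rightarrow> 'a set set set" where
  "rounded_ideals X = {I. I \<subseteq> fam X \<and>
     (\<forall>S. finite S \<and> S \<subseteq> I \<longrightarrow> (\<exists>F\<in>I. \<forall>N\<in>S. N \<subseteq> upper_approx X F)) \<and>
     (\<forall>F\<in>I. \<forall>G\<in>fam X. G \<subseteq> upper_approx X F \<longrightarrow> G \<in> I)}"

text \<open>The ideal generated from below: \<open>F\<close> itself belongs to it only if
  \<open>F \<subseteq> upper_approx X F\<close>, which topological spaces guarantee.\<close>

definition principal_ideal :: "'a space \<Rightarrow> 'a set \<Rightarrow> 'a set set" where
  "principal_ideal X F = {G \<in> fam X. G \<subseteq> upper_approx X F}"

text \<open>The flag \<open>e\<close> admits the empty union; this is all that distinguishes L-approximation spaces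
  from sL-approximation spaces.\<close>

definition local_sups :: "bool \<Rightarrow> 'a space \<Rightarrow> bool" where
  "local_sups e X \<longleftrightarrow> CF_space X \<and>
     (\<forall>S F. finite S \<and> S \<subseteq> fam X \<and> (S \<noteq> {} \<or> e) \<and> F \<in> fam X \<and> \<Union>S \<subseteq> upper_approx X F \<longrightarrow>
        (\<exists>G\<in>fam X. sL1 X (\<Union>S) F G \<and> sL2 X (\<Union>S) F G))"

lemma ball_fam_sharp:
  "(\<forall>M\<in>fam_sharp X. Q M) \<longleftrightarrow> (\<forall>S. S \<subseteq> fam X \<and> finite S \<and> S \<noteq> {} \<longrightarrow> Q (\<Union>S))"
  unfolding fam_sharp_def by auto

text \<open>Adding the set \<open>{}\<close> to \<open>fam_sharp X\<close> amounts to admitting the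
  empty subfamily, so both kinds of spaces can be treated through finite subfamilies.\<close>

lemma ball_fam_sharp_empty:
  "(\<forall>M\<in>fam_sharp X \<union> {{}}. Q M) \<longleftrightarrow> (\<forall>S. S \<subseteq> fam X \<and> finite S \<longrightarrow> Q (\<Union>S))"
  (is "?l \<longleftrightarrow> ?r")
proof
  assume r: ?r
  then have "Q (\<Union>{})" by blast
  with r show ?l by (simp add: ball_Un ball_fam_sharp)
next
  assume l: ?l
  then have "Q {}" "\<And>S. S \<subseteq> fam X \<and> finite S \<and> S \<noteq> {} \<Longrightarrow> Q (\<Union>S)"
    by (simp_all add: ball_Un ball_fam_sharp)
  then show ?r by (metis Sup_empty)
qed

lemma sL_space_imp_CF_space: "sL_space X \<Longrightarrow> CF_space X"
  and L_space_imp_CF_space: "L_space X \<Longrightarrow> CF_space X"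
  and bc_space_imp_CF_space: "bc_space X \<Longrightarrow> CF_space X"
  by (simp_all only: sL_space_def L_space_def bc_space_def)

lemma sL_space_iff: "sL_space X \<longleftrightarrow> local_sups False X"
  unfolding sL_space_def local_sups_def ball_fam_sharp by auto

lemma L_space_iff: "L_space X \<longleftrightarrow> local_sups True X"
  unfolding L_space_def local_sups_def ball_fam_sharp_empty by auto

lemma bc_space_iff: "bc_space X \<longleftrightarrow> CF_space X \<and>
     (\<forall>S F. finite S \<and> S \<subseteq> fam X \<and> F \<in> fam X \<and> \<Union>S \<subseteq> upper_approx X F \<longrightarrow>
        (\<exists>G\<in>fam X. sL1 X (\<Union>S) F G \<and> sL2' X (\<Union>S) G))"
  unfolding bc_space_def ball_fam_sharp_empty by auto

lemma sL2'_imp_sL2: "sL2' X M G \<Longrightarrow> sL2 X M F G"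
  by (simp add: sL2'_def sL2_def)

lemma bc_space_imp_L_space: "bc_space X \<Longrightarrow> L_space X"
  unfolding bc_space_def L_space_def using sL2'_imp_sL2 by metis

lemma upper_approx_mono: "A \<subseteq> A' \<Longrightarrow> upper_approx X A \<subseteq> upper_approx X A'"
  by (auto simp: upper_approx_def)

locale cf_space =
  fixes X :: "'a space"
  assumes CF: "CF_space X"
begin

abbreviation "U \<equiv> upper_approx X"

lemma trans_rel: "trans (rel X)"
  and fam_finite: "F \<in> fam X \<Longrightarrow> finite F"
  and fam_points: "F \<in> fam X \<Longrightarrow> F \<subseteq> points X"
  and fam_nonempty: "fam X \<noteq> {}"
  using CF by (simp_all add: CF_space_def)

lemma upper_approx_subset:
  assumes "F \<subseteq> U G" shows "U F \<subseteq> U G"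
proof
  fix x assume "x \<in> U F"
  then obtain y where y: "x \<in> points X" "y \<in> F" "(x, y) \<in> rel X" by (auto simp: upper_approx_def)
  with assms obtain z where "z \<in> G" "(y, z) \<in> rel X" by (auto simp: upper_approx_def)
  with y transD[OF trans_rel, of x y z] show "x \<in> U G" by (auto simp: upper_approx_def)
qed

lemma below_trans: "\<lbrakk>F \<subseteq> U G; G \<subseteq> U H\<rbrakk> \<Longrightarrow> F \<subseteq> U H"
  by (rule subset_trans[OF _ upper_approx_subset])

lemma CF_interpolation:
  "\<lbrakk>F \<in> fam X; finite K; K \<subseteq> U F\<rbrakk> \<Longrightarrow> \<exists>G\<in>fam X. K \<subseteq> U G \<and> G \<subseteq> U F"
  using CF by (simp add: CF_space_def)

text \<open>A finite family of finite sets has a finite union, and this union can be taken as the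
  set \<open>K\<close> of the CF condition.\<close>

lemma fam_interpolation:
  assumes "F \<in> fam X" "finite S" "S \<subseteq> fam X" "\<And>N. N \<in> S \<Longrightarrow> N \<subseteq> U F"
  shows "\<exists>G\<in>fam X. (\<forall>N\<in>S. N \<subseteq> U G) \<and> G \<subseteq> U F"
proof -
  have "finite (\<Union>S)" using assms(2,3) fam_finite by blast
  moreover have "\<Union>S \<subseteq> U F" using assms(4) by blast
  ultimately show ?thesis using CF_interpolation[OF assms(1), of "\<Union>S"] by blast
qed

lemma ideal_fam: "I \<in> rounded_ideals X \<Longrightarrow> I \<subseteq> fam X"
  and ideal_bound: "\<lbrakk>I \<in> rounded_ideals X; finite S; S \<subseteq> I\<rbrakk> \<Longrightarrow> \<exists>F\<in>I. \<forall>N\<in>S. N \<subseteq> U F"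
  and ideal_down: "\<lbrakk>I \<in> rounded_ideals X; F \<in> I; G \<in> fam X; G \<subseteq> U F\<rbrakk> \<Longrightarrow> G \<in> I"
  by (simp_all add: rounded_ideals_def)

lemma ideal_bound2:
  assumes "I \<in> rounded_ideals X" "F \<in> I" "G \<in> I"
  shows "\<exists>H\<in>I. F \<subseteq> U H \<and> G \<subseteq> U H"
  using ideal_bound[OF assms(1), of "{F, G}"] assms(2,3) by auto

lemma ideal_nonempty: "I \<in> rounded_ideals X \<Longrightarrow> I \<noteq> {}"
  using ideal_bound[of I "{}"] by blast

lemma ideal_mem_iff:
  assumes "I \<in> rounded_ideals X"
  shows "F \<in> I \<longleftrightarrow> F \<in> fam X \<and> (\<exists>G\<in>I. F \<subseteq> U G)"
  using ideal_bound2[OF assms, of F F] ideal_down[OF assms, of _ F] ideal_fam[OF assms] by blast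

lemma principal_ideal_rounded:
  assumes "F \<in> fam X"
  shows "principal_ideal X F \<in> rounded_ideals X"
  unfolding rounded_ideals_def mem_Collect_eq
proof (intro conjI allI impI ballI)
  show "principal_ideal X F \<subseteq> fam X" by (auto simp: principal_ideal_def)
next
  fix S assume "finite S \<and> S \<subseteq> principal_ideal X F"
  then have "finite S" "S \<subseteq> fam X" "\<And>N. N \<in> S \<Longrightarrow> N \<subseteq> U F" by (auto simp: principal_ideal_def)
  from fam_interpolation[OF assms this] show "\<exists>G\<in>principal_ideal X F. \<forall>N\<in>S. N \<subseteq> U G"
    by (auto simp: principal_ideal_def)
next
  fix G H assume "G \<in> principal_ideal X F" "H \<in> fam X" "H \<subseteq> U G"
  then show "H \<in> principal_ideal X F" using below_trans[of H G F] by (simp add: principal_ideal_def)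
qed

lemma principal_ideal_subset:
  "\<lbrakk>I \<in> rounded_ideals X; F \<in> I\<rbrakk> \<Longrightarrow> principal_ideal X F \<subseteq> I"
  using ideal_down[of I F] by (auto simp: principal_ideal_def)

lemma principal_ideal_mono: "F \<subseteq> U G \<Longrightarrow> principal_ideal X F \<subseteq> principal_ideal X G"
  using below_trans[of _ F G] by (auto simp: principal_ideal_def)

text \<open>A finite \<open>F\<close> covered by the union of \<open>I\<close> is covered by
  finitely many members of \<open>I\<close>. Their common bound \<open>H\<close> in \<open>I\<close>
  then has \<open>F\<close> in its approximation, and \<open>I\<close> is closed downwards.\<close>

lemma ideal_eq_Union:
  assumes I: "I \<in> rounded_ideals X"
  shows "I = {F \<in> fam X. F \<subseteq> \<Union>I}"
proof -
  have "F \<in> I" if F: "F \<in> fam X" "F \<subseteq> \<Union>I" for F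
  proof -
    from F(2) have "\<forall>x\<in>F. \<exists>N. N \<in> I \<and> x \<in> N" by blast
    then obtain N where N: "\<forall>x\<in>F. N x \<in> I \<and> x \<in> N x" by (rule bchoice[THEN exE])
    then obtain H where "H \<in> I" "\<forall>M\<in>N ` F. M \<subseteq> U H"
      using ideal_bound[OF I, of "N ` F"] fam_finite[OF F(1)] by blast
    with N have "F \<subseteq> U H" by blast
    with \<open>H \<in> I\<close> show ?thesis using ideal_down[OF I] F(1) by blast
  qed
  then show ?thesis using ideal_fam[OF I] by blast
qed

text \<open>A rounded ideal is determined by its union, so there are no more rounded ideals than sets
  of points; the unions are the CF-closed sets.\<close>

lemma rounded_ideals_lepoll: "rounded_ideals X \<lesssim> Pow (points X)"
  unfolding lepoll_def
proof (intro exI conjI)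
  show "inj_on Union (rounded_ideals X)"
  proof (rule inj_onI)
    fix I J assume "I \<in> rounded_ideals X" "J \<in> rounded_ideals X" "\<Union>I = \<Union>J"
    with ideal_eq_Union[of I] ideal_eq_Union[of J] show "I = J" by simp
  qed
  show "Union ` rounded_ideals X \<subseteq> Pow (points X)"
    using ideal_fam fam_points by fastforce
qed

text \<open>By directedness a finite part of the union already lies in one of the ideals, which
  supplies the bound.\<close>

lemma Union_rounded_ideal:
  assumes "D \<subseteq> rounded_ideals X" "D \<noteq> {}"
    and dir: "\<And>I J. \<lbrakk>I \<in> D; J \<in> D\<rbrakk> \<Longrightarrow> \<exists>K\<in>D. I \<subseteq> K \<and> J \<subseteq> K"
  shows "\<Union>D \<in> rounded_ideals X"
proof -
  have cover: "\<exists>I\<in>D. S \<subseteq> I" if "finite S" "S \<subseteq> \<Union>D" for S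
    using that
  proof (induction S rule: finite_induct)
    case empty
    then show ?case using assms(2) by blast
  next
    case (insert N S)
    then obtain I J where "I \<in> D" "S \<subseteq> I" "J \<in> D" "N \<in> J" by auto
    with dir[of I J] show ?case by blast
  qed
  show ?thesis
    unfolding rounded_ideals_def mem_Collect_eq
  proof (intro conjI allI impI ballI)
    show "\<Union>D \<subseteq> fam X" using assms(1) ideal_fam by fastforce
  next
    fix S assume "finite S \<and> S \<subseteq> \<Union>D"
    with cover obtain I where "I \<in> D" "S \<subseteq> I" "finite S" by blast
    moreover from this ideal_bound[of I S] assms(1) have "\<exists>F\<in>I. \<forall>N\<in>S. N \<subseteq> U F" by blast
    ultimately show "\<exists>F\<in>\<Union>D. \<forall>N\<in>S. N \<subseteq> U F" by blast
  next
    fix F G assume "F \<in> \<Union>D" "G \<in> fam X" "G \<subseteq> U F"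
    then show "G \<in> \<Union>D" using assms(1) ideal_down[of _ F G] by blast
  qed
qed

end

section \<open>Joins of rounded ideals below a given rounded ideal\<close>

definition join_datum ::
  "bool \<Rightarrow> 'a space \<Rightarrow> 'a set set set \<Rightarrow> 'a set set \<Rightarrow> 'a set set \<Rightarrow> 'a set \<Rightarrow> 'a set \<Rightarrow> bool" where
  "join_datum e X A I S H G \<longleftrightarrow> finite S \<and> S \<subseteq> \<Union>A \<and> (S \<noteq> {} \<or> e) \<and> H \<in> I \<and>
     \<Union>S \<subseteq> upper_approx X H \<and> G \<in> fam X \<and> sL1 X (\<Union>S) H G \<and> sL2 X (\<Union>S) H G"

text \<open>The join of the rounded ideals in \<open>A\<close> below a rounded ideal \<open>I\<close> is generated by the
  joins, relative to members of \<open>I\<close>, of finite subsets of \<open>\<Union>A\<close>.\<close>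

definition ideal_join :: "bool \<Rightarrow> 'a space \<Rightarrow> 'a set set set \<Rightarrow> 'a set set \<Rightarrow> 'a set set" where
  "ideal_join e X A I =
     {F \<in> fam X. \<exists>S H G. join_datum e X A I S H G \<and> F \<subseteq> upper_approx X G}"

locale local_sups_space = cf_space +
  fixes e :: bool and A :: "'a set set set" and I :: "'a set set"
  assumes sups: "local_sups e X"
    and I: "I \<in> rounded_ideals X"
    and A: "A \<subseteq> rounded_ideals X" "\<And>J. J \<in> A \<Longrightarrow> J \<subseteq> I" "A \<noteq> {} \<or> e"
begin

abbreviation "datum \<equiv> join_datum e X A I"

lemma Union_A: "\<Union>A \<subseteq> I"
  using A(2) by auto

lemma datumD:
  assumes "datum S H G"
  shows "finite S" "S \<subseteq> \<Union>A" "S \<noteq> {} \<or> e" "H \<in> I" "H \<in> fam X" "\<Union>S \<subseteq> U H" "G \<in> fam X"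
    "U (\<Union>S) \<subseteq> U G" "U G \<subseteq> U H"
    "\<And>G'. \<lbrakk>G' \<in> fam X; U (\<Union>S) \<subseteq> U G'; U G' \<subseteq> U H\<rbrakk> \<Longrightarrow> U G \<subseteq> U G'"
  using assms ideal_fam[OF I] by (auto simp only: join_datum_def sL1_def sL2_def)

lemma datum_exists:
  assumes "finite S" "S \<subseteq> \<Union>A" "S \<noteq> {} \<or> e" "H \<in> I" "\<Union>S \<subseteq> U H"
  shows "\<exists>G. datum S H G"
proof -
  have "S \<subseteq> fam X" "H \<in> fam X" using assms(2,4) Union_A ideal_fam[OF I] by auto
  with assms sups show ?thesis by (simp add: local_sups_def join_datum_def Bex_def)
qed

text \<open>\<open>G\<close> stays below the larger bound \<open>K\<close>, so minimality of
  \<open>G'\<close> puts \<open>G'\<close> under \<open>G\<close> and hence below \<open>H\<close>.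
  There it competes with \<open>G\<close>, and minimality of \<open>G\<close> gives the
  converse.\<close>

lemma datum_change_bound:
  assumes 1: "datum S H G" and 2: "datum S K G'" and HK: "H \<subseteq> U K"
  shows "U G = U G'"
proof
  have "U G \<subseteq> U K" using datumD(9)[OF 1] upper_approx_subset[OF HK] by (rule subset_trans)
  then show "U G' \<subseteq> U G" by (rule datumD(10)[OF 2 datumD(7,8)[OF 1]])
  then have "U G' \<subseteq> U H" using datumD(9)[OF 1] by (rule subset_trans)
  then show "U G \<subseteq> U G'" by (rule datumD(10)[OF 1 datumD(7,8)[OF 2]])
qed

lemma bound_in_I:
  assumes "finite S" "S \<subseteq> \<Union>A"
  shows "\<exists>H\<in>I. \<Union>S \<subseteq> U H"
  using ideal_bound[OF I assms(1) subset_trans[OF assms(2) Union_A]] by (simp add: Sup_le_iff)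

text \<open>Both joins are recomputed relative to a common bound \<open>K\<close> in
  \<open>I\<close>, which leaves their upper approximations unchanged; relative to \<open>K\<close>
  the join of \<open>S \<union> S'\<close> dominates them.\<close>

lemma datum_bound:
  assumes 1: "datum S H G" and 2: "datum S' H' G'"
  shows "\<exists>S'' K G''. datum S'' K G'' \<and> U G \<subseteq> U G'' \<and> U G' \<subseteq> U G''"
proof -
  obtain K where K: "K \<in> I" "H \<subseteq> U K" "H' \<subseteq> U K"
    using ideal_bound2[OF I datumD(4)[OF 1] datumD(4)[OF 2]] by blast
  have SK: "\<Union>S \<subseteq> U K" "\<Union>S' \<subseteq> U K"
    using below_trans[OF datumD(6)[OF 1] K(2)] below_trans[OF datumD(6)[OF 2] K(3)] .
  obtain G1 where G1: "datum S K G1" using datum_exists[OF datumD(1-3)[OF 1] K(1) SK(1)] by blast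
  obtain G2 where G2: "datum S' K G2" using datum_exists[OF datumD(1-3)[OF 2] K(1) SK(2)] by blast
  have "\<exists>G. datum (S \<union> S') K G"
    using datumD(1-3)[OF 1] datumD(1-3)[OF 2] K(1) SK by (intro datum_exists) auto
  then obtain G'' where G'': "datum (S \<union> S') K G''" by blast
  have "U (\<Union>S) \<subseteq> U G''" "U (\<Union>S') \<subseteq> U G''"
    by (auto intro!: subset_trans[OF upper_approx_mono datumD(8)[OF G'']])
  then have "U G1 \<subseteq> U G''" "U G2 \<subseteq> U G''"
    using datumD(10)[OF G1 datumD(7)[OF G'']] datumD(10)[OF G2 datumD(7)[OF G'']]
      datumD(9)[OF G''] by simp_all
  then show ?thesis
    using datum_change_bound[OF 1 G1 K(2)] datum_change_bound[OF 2 G2 K(3)] G'' by auto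
qed

lemma ideal_join_rounded: "ideal_join e X A I \<in> rounded_ideals X" (is "?J \<in> _")
proof -
  \<comment> \<open>This makes the join nonempty. With \<open>e\<close> the empty \<open>S\<close>
    will do; otherwise \<open>A\<close> contains an ideal, and one of its members gives a
    singleton.\<close>
  have single: "\<exists>S H G. datum S H G"
  proof -
    obtain S where S: "finite S" "S \<subseteq> \<Union>A" "S \<noteq> {} \<or> e"
    proof (cases e)
      case False
      with A(3) obtain J where J: "J \<in> A" by blast
      with A(1) ideal_nonempty[of J] obtain N where "N \<in> J" by blast
      with J that[of "{N}"] show ?thesis by blast
    qed (use that[of "{}"] in simp)
    from bound_in_I[OF S(1,2)] obtain H where H: "H \<in> I" "\<Union>S \<subseteq> U H" by blast
    with datum_exists[OF S H] show ?thesis by blast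
  qed
  have bound: "\<exists>S H G. datum S H G \<and> (\<forall>F\<in>T. F \<subseteq> U G)" if "finite T" "T \<subseteq> ?J" for T
    using that
  proof (induction T rule: finite_induct)
    case empty
    then show ?case using single by simp
  next
    case (insert F T)
    then obtain S H G where 1: "datum S H G" "\<forall>F\<in>T. F \<subseteq> U G" by auto
    from insert.prems obtain S' H' G' where 2: "datum S' H' G'" "F \<subseteq> U G'"
      by (auto simp: ideal_join_def)
    from datum_bound[OF 1(1) 2(1)] obtain S'' K G'' where
      d: "datum S'' K G''" "U G \<subseteq> U G''" "U G' \<subseteq> U G''" by blast
    have "N \<subseteq> U G''" if "N \<in> insert F T" for N
      using that 1(2) 2(2) subset_trans[OF _ d(2), of N] subset_trans[OF _ d(3), of N] by auto
    with d(1) show ?case by blast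
  qed
  show ?thesis
    unfolding rounded_ideals_def mem_Collect_eq
  proof (intro conjI allI impI ballI)
    show "?J \<subseteq> fam X" by (auto simp: ideal_join_def)
  next
    fix T assume T: "finite T \<and> T \<subseteq> ?J"
    with bound[of T] obtain S H G where G: "datum S H G" "\<forall>F\<in>T. F \<subseteq> U G" by blast
    have "finite T" "T \<subseteq> fam X" using T by (auto simp: ideal_join_def)
    \<comment> \<open>Without reflexivity \<open>G\<close> need not belong to the join that it helps
      to generate, so a bound of \<open>T\<close> is interpolated strictly below
      \<open>G\<close>.\<close>
    then have "\<exists>K\<in>fam X. (\<forall>F\<in>T. F \<subseteq> U K) \<and> K \<subseteq> U G"
      by (rule fam_interpolation[OF datumD(7)[OF G(1)]]) (use G(2) in blast)
    then obtain K where K: "K \<in> fam X" "\<forall>F\<in>T. F \<subseteq> U K" "K \<subseteq> U G" by blast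
    with G(1) have "K \<in> ?J" by (auto simp: ideal_join_def)
    with K(2) show "\<exists>F\<in>?J. \<forall>N\<in>T. N \<subseteq> U F" by blast
  next
    fix F G assume F: "F \<in> ?J" "G \<in> fam X" "G \<subseteq> U F"
    then obtain S H K where "datum S H K" "F \<subseteq> U K" by (auto simp: ideal_join_def)
    with F below_trans[of G F K] show "G \<in> ?J" by (auto simp: ideal_join_def)
  qed
qed

lemma ideal_join_le: "ideal_join e X A I \<subseteq> I"
proof
  fix F assume "F \<in> ideal_join e X A I"
  then obtain S H G where F: "F \<in> fam X" "datum S H G" "F \<subseteq> U G"
    by (auto simp: ideal_join_def)
  have "F \<subseteq> U H" using F(3) datumD(9)[OF F(2)] by (rule subset_trans)
  then show "F \<in> I" by (rule ideal_down[OF I datumD(4)[OF F(2)] F(1)])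
qed

text \<open>Roundedness of \<open>J\<close> places \<open>F\<close> in the approximation of another
  member \<open>N\<close>, and the join of the singleton \<open>{N}\<close> lies above
  \<open>N\<close>.\<close>

lemma ideal_join_upper:
  assumes "J \<in> A" shows "J \<subseteq> ideal_join e X A I"
proof
  fix F assume F: "F \<in> J"
  have J: "J \<in> rounded_ideals X" using A(1) assms by blast
  from F obtain N where N: "N \<in> J" "F \<subseteq> U N" "F \<in> fam X" using ideal_mem_iff[OF J] by blast
  then have S: "finite {N}" "{N} \<subseteq> \<Union>A" "{N} \<noteq> {} \<or> e" using assms by auto
  obtain H where H: "H \<in> I" "\<Union>{N} \<subseteq> U H" using bound_in_I[OF S(1,2)] by blast
  obtain G where G: "datum {N} H G" using datum_exists[OF S H] by blast
  then have "F \<subseteq> U G" using subset_trans[OF N(2), of "U G"] datumD(8)[OF G] by simp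
  then show "F \<in> ideal_join e X A I" using G N(3) by (auto simp: ideal_join_def)
qed

text \<open>The finite set \<open>S\<close> lies in \<open>J\<close> and so has a bound
  \<open>H'\<close> there. As \<open>J\<close> is contained in \<open>I\<close>, some
  \<open>K\<close> in \<open>I\<close> lies above both \<open>H\<close> and \<open>H'\<close>.
  Relative to \<open>K\<close>, \<open>H'\<close> is a competitor of the join of \<open>S\<close>,
  which by the change of bound agrees with \<open>G\<close>.\<close>

lemma ideal_join_least:
  assumes J: "J \<in> rounded_ideals X" "J \<subseteq> I" "\<And>J'. J' \<in> A \<Longrightarrow> J' \<subseteq> J"
  shows "ideal_join e X A I \<subseteq> J"
proof
  fix F assume "F \<in> ideal_join e X A I"
  then obtain S H G where d: "datum S H G" and F: "F \<subseteq> U G" "F \<in> fam X"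
    by (auto simp: ideal_join_def)
  have "S \<subseteq> J" using datumD(2)[OF d] J(3) by auto
  then obtain H' where H': "H' \<in> J" "\<Union>S \<subseteq> U H'"
    using ideal_bound[OF J(1) datumD(1)[OF d]] by (auto simp: Sup_le_iff)
  obtain K where K: "K \<in> I" "H \<subseteq> U K" "H' \<subseteq> U K"
    using ideal_bound2[OF I datumD(4)[OF d], of H'] H'(1) J(2) by blast
  obtain G' where G': "datum S K G'"
    using datum_exists[OF datumD(1-3)[OF d] K(1) below_trans[OF datumD(6)[OF d] K(2)]] by blast
  have "H' \<in> fam X" using H'(1) ideal_fam[OF J(1)] by blast
  then have "U G' \<subseteq> U H'"
    by (rule datumD(10)[OF G' _ upper_approx_subset[OF H'(2)] upper_approx_subset[OF K(3)]])
  then have "F \<subseteq> U H'" using F(1) datum_change_bound[OF d G' K(2)] by simp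
  then show "F \<in> J" by (rule ideal_down[OF J(1) H'(1) F(2)])
qed

text \<open>(sL-2') compares the join of \<open>S\<close> directly with the bound \<open>H'\<close>
  taken in \<open>J\<close>. No common bound of \<open>H\<close> and \<open>H'\<close> enters, so
  \<open>J\<close> may be any upper bound of \<open>A\<close>, also one outside
  \<open>I\<close>.\<close>

lemma ideal_join_least_bc:
  assumes bc: "bc_space X" and J: "J \<in> rounded_ideals X" "\<And>J'. J' \<in> A \<Longrightarrow> J' \<subseteq> J"
  shows "ideal_join e X A I \<subseteq> J"
proof
  fix F assume "F \<in> ideal_join e X A I"
  then obtain S H G where d: "datum S H G" and F: "F \<subseteq> U G" "F \<in> fam X"
    by (auto simp: ideal_join_def)
  have "S \<subseteq> J" using datumD(2)[OF d] J(2) by auto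
  then obtain H' where H': "H' \<in> J" "\<Union>S \<subseteq> U H'"
    using ideal_bound[OF J(1) datumD(1)[OF d]] by (auto simp: Sup_le_iff)
  have "S \<subseteq> fam X" using \<open>S \<subseteq> J\<close> ideal_fam[OF J(1)] by (rule subset_trans)
  with bc datumD(1,5,6)[OF d] obtain G' where G': "G' \<in> fam X" "sL1 X (\<Union>S) H G'" "sL2' X (\<Union>S) G'"
    unfolding bc_space_iff by blast
  have "U G \<subseteq> U G'" using datumD(10)[OF d G'(1)] G'(2) by (simp add: sL1_def)
  moreover have "H' \<in> fam X" using H'(1) ideal_fam[OF J(1)] by blast
  then have "U G' \<subseteq> U H'"
    using G'(3) upper_approx_subset[OF H'(2)] by (simp add: sL2'_def)
  ultimately have "F \<subseteq> U H'" using F(1) by simp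
  then show "F \<in> J" by (rule ideal_down[OF J(1) H'(1) F(2)])
qed

end

section \<open>Ideal completion\<close>

text \<open>\<open>L\<close> is determined up to isomorphism and need not consist of sets, so a
  given domain and an encoded family of ideals are treated alike. Equality is fixed because a
  \<open>gorder\<close> carries an equivalence of its own.\<close>

locale ideal_completion = cf_space X for X :: "'a space" +
  fixes L :: "'b gorder" (structure) and \<kappa> :: "'b \<Rightarrow> 'a set set"
  assumes bij: "bij_betw \<kappa> (carrier L) (rounded_ideals X)"
    and eq_L: "eq L = (=)"
    and le_iff: "\<lbrakk>x \<in> carrier L; y \<in> carrier L\<rbrakk> \<Longrightarrow> x \<sqsubseteq> y \<longleftrightarrow> \<kappa> x \<subseteq> \<kappa> y"
begin

lemma rounded: "x \<in> carrier L \<Longrightarrow> \<kappa> x \<in> rounded_ideals X"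
  using bij by (rule bij_betw_apply)

lemma kappa_eq_iff: "\<lbrakk>x \<in> carrier L; y \<in> carrier L\<rbrakk> \<Longrightarrow> \<kappa> x = \<kappa> y \<longleftrightarrow> x = y"
  by (rule inj_on_eq_iff[OF bij_betw_imp_inj_on[OF bij]])

lemma element: "I \<in> rounded_ideals X \<Longrightarrow> \<exists>x\<in>carrier L. \<kappa> x = I"
  using bij_betw_imp_surj_on[OF bij] by (metis imageE)

sublocale partial_order L
proof
  have "x = y" if "x \<sqsubseteq> y" "y \<sqsubseteq> x" "x \<in> carrier L" "y \<in> carrier L" for x y
    using that by (simp add: le_iff kappa_eq_iff[symmetric])
  then show "x .= y" if "x \<sqsubseteq> y" "y \<sqsubseteq> x" "x \<in> carrier L" "y \<in> carrier L" for x y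
    using that by (simp add: eq_L)
qed (auto simp: eq_L le_iff)

lemma is_lub_Union:
  assumes "D \<subseteq> carrier L" "s \<in> carrier L" "\<kappa> s = (\<Union>d\<in>D. \<kappa> d)"
  shows "is_lub L s D"
  unfolding is_lub_iff[OF assms(1)]
proof (intro conjI ballI impI)
  show "a \<sqsubseteq> s" if "a \<in> D" for a
    using that assms by (auto simp: le_iff subset_iff[of D])
  show "s \<sqsubseteq> u" if "u \<in> carrier L" "\<forall>a\<in>D. a \<sqsubseteq> u" for u
    using that assms(1) le_iff[of _ u] by (auto simp: le_iff[OF assms(2)] assms(3))
qed (rule assms)

lemma directed_Union_rounded:
  assumes "directed L D"
  shows "(\<Union>d\<in>D. \<kappa> d) \<in> rounded_ideals X"
proof (rule Union_rounded_ideal)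
  have D: "D \<subseteq> carrier L" "D \<noteq> {}" using assms by (simp_all add: directed_def)
  then show "\<kappa> ` D \<subseteq> rounded_ideals X" "\<kappa> ` D \<noteq> {}" using rounded by auto
  fix I J assume "I \<in> \<kappa> ` D" "J \<in> \<kappa> ` D"
  then obtain x y where xy: "x \<in> D" "y \<in> D" "I = \<kappa> x" "J = \<kappa> y" by auto
  then obtain z where z: "z \<in> D" "x \<sqsubseteq> z" "y \<sqsubseteq> z"
    using assms unfolding directed_def by blast
  moreover have "x \<in> carrier L" "y \<in> carrier L" "z \<in> carrier L" using xy(1,2) z(1) D by auto
  ultimately have "I \<subseteq> \<kappa> z" "J \<subseteq> \<kappa> z" using xy(3,4) by (simp_all add: le_iff)
  with z(1) show "\<exists>K\<in>\<kappa> ` D. I \<subseteq> K \<and> J \<subseteq> K" by blast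
qed

text \<open>A directed union of rounded ideals is a rounded ideal, so directed suprema are computed
  as unions; uniqueness of suprema gives the forward direction.\<close>

lemma is_lub_directed_iff:
  assumes "directed L D"
  shows "is_lub L s D \<longleftrightarrow> s \<in> carrier L \<and> \<kappa> s = (\<Union>d\<in>D. \<kappa> d)"
proof
  have D: "D \<subseteq> carrier L" using assms by (simp add: directed_def)
  obtain t where t: "t \<in> carrier L" "\<kappa> t = (\<Union>d\<in>D. \<kappa> d)"
    using element[OF directed_Union_rounded[OF assms]] by blast
  then have "is_lub L t D" using is_lub_Union D by blast
  moreover assume "is_lub L s D"
  ultimately have "s = t" by (rule least_unique[rotated])
  with t show "s \<in> carrier L \<and> \<kappa> s = (\<Union>d\<in>D. \<kappa> d)" by simp
next
  have "D \<subseteq> carrier L" using assms by (simp add: directed_def)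
  then show "s \<in> carrier L \<and> \<kappa> s = (\<Union>d\<in>D. \<kappa> d) \<Longrightarrow> is_lub L s D"
    using is_lub_Union by blast
qed

definition generator :: "'a set \<Rightarrow> 'b" where
  "generator F = inv_into (carrier L) \<kappa> (principal_ideal X F)"

lemma generator:
  assumes "F \<in> fam X"
  shows "generator F \<in> carrier L" "\<kappa> (generator F) = principal_ideal X F"
  using bij_betw_inv_into_right[OF bij principal_ideal_rounded[OF assms]]
    bij_betw_apply[OF bij_betw_inv_into[OF bij] principal_ideal_rounded[OF assms]]
  by (simp_all add: generator_def)

lemma dcpo_L: "dcpo L"
  unfolding dcpo_def
proof (intro conjI allI impI)
  show "partial_order L" by unfold_locales
  show "carrier L \<noteq> {}" using fam_nonempty generator(1) by auto
  fix D assume "directed L D"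
  then show "\<exists>s. is_lub L s D"
    using element[OF directed_Union_rounded, of D] by (auto simp: is_lub_directed_iff)
qed

lemma generator_le:
  "\<lbrakk>y \<in> carrier L; F \<in> \<kappa> y\<rbrakk> \<Longrightarrow> F \<in> fam X"
  "\<lbrakk>y \<in> carrier L; F \<in> \<kappa> y\<rbrakk> \<Longrightarrow> generator F \<in> carrier L"
  "\<lbrakk>y \<in> carrier L; F \<in> \<kappa> y\<rbrakk> \<Longrightarrow> generator F \<sqsubseteq> y"
proof -
  assume *: "y \<in> carrier L" "F \<in> \<kappa> y"
  then show F: "F \<in> fam X" using ideal_fam[OF rounded] by blast
  then show "generator F \<in> carrier L" by (rule generator)
  then show "generator F \<sqsubseteq> y"
    using * F by (simp add: le_iff generator(2) principal_ideal_subset rounded)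
qed

lemma generators_directed:
  assumes y: "y \<in> carrier L"
  shows "directed L (generator ` \<kappa> y)" "is_lub L y (generator ` \<kappa> y)"
proof -
  have sub: "generator ` \<kappa> y \<subseteq> carrier L" using y generator_le(2) by auto
  show "directed L (generator ` \<kappa> y)"
    unfolding directed_def
  proof (intro conjI ballI sub)
    show "generator ` \<kappa> y \<noteq> {}" using ideal_nonempty[OF rounded[OF y]] by simp
    fix u v assume "u \<in> generator ` \<kappa> y" "v \<in> generator ` \<kappa> y"
    then obtain F G where FG: "F \<in> \<kappa> y" "G \<in> \<kappa> y" "u = generator F" "v = generator G" by auto
    then obtain H where H: "H \<in> \<kappa> y" "F \<subseteq> U H" "G \<subseteq> U H"
      using ideal_bound2[OF rounded[OF y]] by blast
    then have "u \<sqsubseteq> generator H" "v \<sqsubseteq> generator H"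
      using FG y generator_le(1)[OF y] by (simp_all add: le_iff generator principal_ideal_mono)
    with H(1) show "\<exists>z\<in>generator ` \<kappa> y. u \<sqsubseteq> z \<and> v \<sqsubseteq> z" by blast
  qed
  have "F \<in> \<kappa> y \<longleftrightarrow> F \<in> (\<Union>F\<in>\<kappa> y. principal_ideal X F)" for F
    using ideal_mem_iff[OF rounded[OF y], of F] by (simp add: principal_ideal_def)
  then have "\<kappa> y = (\<Union>F\<in>\<kappa> y. principal_ideal X F)" by blast
  also have "\<dots> = (\<Union>d\<in>generator ` \<kappa> y. \<kappa> d)"
    using generator(2) generator_le(1)[OF y] by simp
  finally show "is_lub L y (generator ` \<kappa> y)" by (rule is_lub_Union[OF sub y])
qed

text \<open>Forwards, \<open>y\<close> is the directed supremum of its generators, so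
  \<open>x\<close> lies below one of them. Backwards, directed suprema are unions, so the witness
  \<open>H\<close> is already in the ideal of a single member of \<open>D\<close>.\<close>

lemma way_below_iff:
  assumes x: "x \<in> carrier L" and y: "y \<in> carrier L"
  shows "way_below L x y \<longleftrightarrow> (\<exists>H\<in>\<kappa> y. \<kappa> x \<subseteq> principal_ideal X H)"
proof
  assume "way_below L x y"
  then obtain d where "d \<in> generator ` \<kappa> y" "x \<sqsubseteq> d"
    using generators_directed[OF y] le_refl[OF y] unfolding way_below_def by blast
  then obtain H where "H \<in> \<kappa> y" "x \<sqsubseteq> generator H" by blast
  with x y show "\<exists>H\<in>\<kappa> y. \<kappa> x \<subseteq> principal_ideal X H"
    using generator_le(1)[OF y] by (auto simp: le_iff generator)
next
  assume "\<exists>H\<in>\<kappa> y. \<kappa> x \<subseteq> principal_ideal X H"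
  then obtain H where H: "H \<in> \<kappa> y" "\<kappa> x \<subseteq> principal_ideal X H" by blast
  show "way_below L x y"
    unfolding way_below_def
  proof (intro conjI allI impI x y)
    fix D s assume D: "directed L D \<and> is_lub L s D \<and> y \<sqsubseteq> s"
    then have s: "s \<in> carrier L" "\<kappa> s = (\<Union>d\<in>D. \<kappa> d)" using is_lub_directed_iff[of D s] by simp_all
    have DL: "D \<subseteq> carrier L" using D by (simp add: directed_def)
    have "\<kappa> y \<subseteq> (\<Union>d\<in>D. \<kappa> d)" using D le_iff[OF y s(1)] s(2) by simp
    with H(1) obtain d where d: "d \<in> D" "H \<in> \<kappa> d" by blast
    with DL have "d \<in> carrier L" by blast
    moreover have "\<kappa> x \<subseteq> \<kappa> d"
      using H(2) principal_ideal_subset[OF rounded[OF \<open>d \<in> carrier L\<close>] d(2)] by blast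
    ultimately show "\<exists>d\<in>D. x \<sqsubseteq> d" using d(1) le_iff[OF x, of d] by blast
  qed
qed

lemma generator_way_below: "\<lbrakk>y \<in> carrier L; F \<in> \<kappa> y\<rbrakk> \<Longrightarrow> way_below L (generator F) y"
  using way_below_iff[of "generator F" y] generator generator_le(1,2)[of y F] by auto

text \<open>Every set between the generators of \<open>y\<close> and the elements way below
  \<open>y\<close> is directed with supremum \<open>y\<close>. Taking all elements way below
  \<open>y\<close> gives continuity, taking the compact elements below \<open>y\<close> gives
  algebraicity.\<close>

lemma directed_cofinal:
  assumes y: "y \<in> carrier L" and gen: "generator ` \<kappa> y \<subseteq> D"
    and D: "\<And>x. x \<in> D \<Longrightarrow> way_below L x y"
  shows "directed L D" "is_lub L y D"
proof -
  have DL: "D \<subseteq> carrier L" using D by (auto simp: way_below_def)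
  have ev: "\<exists>d\<in>generator ` \<kappa> y. x \<sqsubseteq> d" if "x \<in> D" for x
    using D[OF that] generators_directed[OF y] le_refl[OF y] unfolding way_below_def by blast
  show "directed L D"
    unfolding directed_def
  proof (intro conjI ballI DL)
    show "D \<noteq> {}" using generators_directed(1)[OF y] gen by (auto simp: directed_def)
    fix u v assume uv: "u \<in> D" "v \<in> D"
    then obtain d d' where d: "d \<in> generator ` \<kappa> y" "u \<sqsubseteq> d" "d' \<in> generator ` \<kappa> y" "v \<sqsubseteq> d'"
      using ev by meson
    then obtain z where z: "z \<in> generator ` \<kappa> y" "d \<sqsubseteq> z" "d' \<sqsubseteq> z"
      using generators_directed(1)[OF y] unfolding directed_def by blast
    have "u \<sqsubseteq> z" using le_trans[OF d(2) z(2)] uv d z gen DL by blast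
    moreover have "v \<sqsubseteq> z" using le_trans[OF d(4) z(3)] uv d z gen DL by blast
    ultimately show "\<exists>z\<in>D. u \<sqsubseteq> z \<and> v \<sqsubseteq> z" using z gen by blast
  qed
  have "\<kappa> x \<subseteq> \<kappa> y" if x: "x \<in> D" for x
  proof -
    obtain H where "H \<in> \<kappa> y" "\<kappa> x \<subseteq> principal_ideal X H"
      using D[OF x] way_below_iff[OF _ y, of x] x DL by blast
    with principal_ideal_subset[OF rounded[OF y], of H] show ?thesis by simp
  qed
  moreover have "\<kappa> y = (\<Union>d\<in>generator ` \<kappa> y. \<kappa> d)"
    using generators_directed[OF y] is_lub_directed_iff[of "generator ` \<kappa> y" y] by simp
  ultimately have "\<kappa> y = (\<Union>d\<in>D. \<kappa> d)" using gen by blast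
  then show "is_lub L y D" by (rule is_lub_Union[OF DL y])
qed

lemma continuous_domain_L: "continuous_domain L"
  unfolding continuous_domain_def
proof (intro conjI ballI dcpo_L)
  fix y assume y: "y \<in> carrier L"
  have "generator ` \<kappa> y \<subseteq> {x. way_below L x y}" using generator_way_below[OF y] by auto
  from directed_cofinal[OF y this]
  show "directed L {x. way_below L x y}" "is_lub L y {x. way_below L x y}" by simp_all
qed

text \<open>Reflexivity makes \<open>F\<close> a member of its own principal ideal, and then
  \<open>generator F\<close> is way below itself.\<close>

lemma algebraic_domain_L:
  assumes "topological X"
  shows "algebraic_domain L"
  unfolding algebraic_domain_def
proof (intro conjI ballI dcpo_L)
  fix y assume y: "y \<in> carrier L"
  let ?D = "down L y \<inter> compacts L"
  interpret based_domain L "carrier L"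
    by (rule continuous_domain_based[OF continuous_domain_L])
  have refl: "refl_on (points X) (rel X)"
    using assms by (simp add: topological_def preorder_on_def)
  have "generator F \<in> ?D" if F: "F \<in> \<kappa> y" for F
  proof -
    have "F \<in> fam X" using y F by (rule generator_le)
    have "a \<in> U F" if "a \<in> F" for a
      using that fam_points[OF \<open>F \<in> fam X\<close>] refl_onD[OF refl, of a] by (auto simp: upper_approx_def)
    then have "F \<in> \<kappa> (generator F)"
      using \<open>F \<in> fam X\<close> by (simp add: generator principal_ideal_def subset_iff)
    then have "way_below L (generator F) (generator F)"
      using \<open>F \<in> fam X\<close> generator_way_below[of "generator F" F] generator(1) by simp
    then show ?thesis using generator_le[OF y F] by (simp add: down_def compacts_def)
  qed
  then have "generator ` \<kappa> y \<subseteq> ?D" by blast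
  moreover have "way_below L x y" if "x \<in> ?D" for x
    using that wb_le_trans[of x x y] y by (simp add: down_def compacts_def)
  ultimately show "directed L ?D" "is_lub L y ?D" using directed_cofinal[OF y] by blast+
qed

section \<open>Lattice conditions on the ideal completion\<close>

lemma local_sup_exists:
  assumes sups: "local_sups e X" and x: "x \<in> carrier L" and bd: "A \<subseteq> down L x" "A \<noteq> {} \<or> e"
  shows "\<exists>s. is_lub (L\<lparr>carrier := down L x\<rparr>) s A"
proof -
  have AL: "A \<subseteq> carrier L" using bd(1) by (auto simp: down_def)
  \<comment> \<open>\<open>A\<close> may be infinite: each member of the join of ideals comes from a
    finite subset of their union.\<close>
  interpret local_sups_space X e "\<kappa> ` A" "\<kappa> x"
  proof
    show "local_sups e X" by fact
    show "\<kappa> x \<in> rounded_ideals X" using x by (rule rounded)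
    show "\<kappa> ` A \<subseteq> rounded_ideals X" using AL rounded by auto
    show "\<And>J. J \<in> \<kappa> ` A \<Longrightarrow> J \<subseteq> \<kappa> x" using bd(1) x le_iff[of _ x] by (auto simp: down_def)
    show "\<kappa> ` A \<noteq> {} \<or> e" using bd(2) by simp
  qed
  obtain s where s: "s \<in> carrier L" "\<kappa> s = ideal_join e X (\<kappa> ` A) (\<kappa> x)"
    using element[OF ideal_join_rounded] by blast
  have "is_lub (L\<lparr>carrier := down L x\<rparr>) s A"
    unfolding is_lub_down_iff[OF bd(1)]
  proof (intro conjI ballI impI s(1))
    show "s \<sqsubseteq> x" using ideal_join_le s x by (simp add: le_iff)
    show "a \<sqsubseteq> s" if "a \<in> A" for a
      using ideal_join_upper[of "\<kappa> a"] that s AL le_iff[of a s] by auto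
    fix u assume u: "u \<in> carrier L" "u \<sqsubseteq> x" "\<forall>a\<in>A. a \<sqsubseteq> u"
    have "\<kappa> s \<subseteq> \<kappa> u"
      unfolding s(2)
    proof (rule ideal_join_least)
      show "\<kappa> u \<in> rounded_ideals X" using u(1) by (rule rounded)
      show "\<kappa> u \<subseteq> \<kappa> x" using u x le_iff by simp
      show "\<And>J. J \<in> \<kappa> ` A \<Longrightarrow> J \<subseteq> \<kappa> u" using u AL le_iff[of _ u] by auto
    qed
    then show "s \<sqsubseteq> u" using s u le_iff by simp
  qed
  then show ?thesis ..
qed

lemma bounded_sup_exists:
  assumes bc: "bc_space X" and bd: "A \<subseteq> carrier L" "x \<in> Upper L A"
  shows "\<exists>s. is_lub L s A"
proof -
  have x: "x \<in> carrier L" "\<And>a. a \<in> A \<Longrightarrow> a \<sqsubseteq> x" using bd by (auto simp: Upper_def)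
  \<comment> \<open>The given upper bound \<open>x\<close> only serves to form the join; the
    bc-condition then makes the result least among all upper bounds.\<close>
  interpret local_sups_space X True "\<kappa> ` A" "\<kappa> x"
  proof
    show "local_sups True X" using bc bc_space_imp_L_space by (simp add: L_space_iff)
    show "\<kappa> x \<in> rounded_ideals X" using x(1) by (rule rounded)
    show "\<kappa> ` A \<subseteq> rounded_ideals X" using bd(1) rounded by auto
    show "\<And>J. J \<in> \<kappa> ` A \<Longrightarrow> J \<subseteq> \<kappa> x" using bd(1) x le_iff[of _ x] by auto
  qed simp
  obtain s where s: "s \<in> carrier L" "\<kappa> s = ideal_join True X (\<kappa> ` A) (\<kappa> x)"
    using element[OF ideal_join_rounded] by blast
  have "is_lub L s A"
    unfolding is_lub_iff[OF bd(1)]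
  proof (intro conjI ballI impI s(1))
    show "a \<sqsubseteq> s" if "a \<in> A" for a
      using ideal_join_upper[of "\<kappa> a"] that s bd(1) le_iff[of a s] by auto
    fix u assume u: "u \<in> carrier L" "\<forall>a\<in>A. a \<sqsubseteq> u"
    have "\<kappa> s \<subseteq> \<kappa> u"
      unfolding s(2)
    proof (rule ideal_join_least_bc[OF bc])
      show "\<kappa> u \<in> rounded_ideals X" using u(1) by (rule rounded)
      show "\<And>J. J \<in> \<kappa> ` A \<Longrightarrow> J \<subseteq> \<kappa> u" using u bd(1) le_iff[of _ u] by auto
    qed
    then show "s \<sqsubseteq> u" using s u le_iff by simp
  qed
  then show ?thesis ..
qed

lemma sL_domain_L:
  assumes "sL_space X"
  shows "sL_domain L"
  unfolding sL_domain_def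
proof (intro conjI ballI continuous_domain_L)
  fix x assume x: "x \<in> carrier L"
  interpret D: partial_order "L\<lparr>carrier := down L x\<rparr>"
    by (rule partial_order_down) unfold_locales
  show "upper_semilattice (L\<lparr>carrier := down L x\<rparr>)"
  proof
    fix y z assume "y \<in> carrier (L\<lparr>carrier := down L x\<rparr>)" "z \<in> carrier (L\<lparr>carrier := down L x\<rparr>)"
    then have "{y, z} \<subseteq> down L x" by simp
    with assms show "\<exists>s. is_lub (L\<lparr>carrier := down L x\<rparr>) s {y, z}"
      using local_sup_exists[of False x] x by (simp add: sL_space_iff)
  qed
qed

lemma L_domain_L:
  assumes "L_space X"
  shows "L_domain L"
  unfolding L_domain_def
proof (intro conjI ballI continuous_domain_L)
  fix x assume x: "x \<in> carrier L"
  interpret D: partial_order "L\<lparr>carrier := down L x\<rparr>"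
    by (rule partial_order_down) unfold_locales
  show "complete_lattice (L\<lparr>carrier := down L x\<rparr>)"
    using assms local_sup_exists[of True x] x
    by (intro D.complete_latticeI_sup) (simp add: L_space_iff)
qed

lemma bc_domain_L: "bc_space X \<Longrightarrow> bc_domain L"
  using continuous_domain_L bounded_sup_exists by (auto simp: bc_domain_def)

end

section \<open>The approximation space of a based domain\<close>

text \<open>With singletons, the approximation of \<open>{b}\<close> is the set of basis elements
  way below \<open>b\<close>. The CF condition becomes interpolation for finite sets, and
  \<open>fam_sharp\<close> consists of the nonempty finite subsets of \<open>B\<close>.\<close>

definition basis_space :: "'a gorder \<Rightarrow> 'a set \<Rightarrow> 'a space" where
  "basis_space L B = \<lparr>points = B, rel = {(a, b). a \<in> B \<and> b \<in> B \<and> way_below L a b},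
     fam = (\<lambda>b. {b}) ` B\<rparr>"

definition approximants :: "'a gorder \<Rightarrow> 'a set \<Rightarrow> 'a \<Rightarrow> 'a set set" where
  "approximants L B x = (\<lambda>b. {b}) ` {b \<in> B. way_below L b x}"

text \<open>Let a directed \<open>D\<close> have a supremum \<open>s\<close> above \<open>g\<close>.
  By compactness a single \<open>d\<close> in \<open>D\<close> bounds \<open>M\<close>, but the join
  \<open>g'\<close> of \<open>M\<close> below \<open>d\<close> need not be its join \<open>g\<close>
  below \<open>f\<close>. Both \<open>g\<close> and \<open>g'\<close> lie below \<open>s\<close>, so
  the join \<open>h\<close> of \<open>M\<close> below \<open>s\<close> is under both. Then
  \<open>h\<close> is below \<open>f\<close>, minimality of \<open>g\<close> gives that
  \<open>g\<close> is below \<open>h\<close>, and hence \<open>g\<close> is below \<open>g'\<close>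
  and \<open>d\<close>.\<close>

lemma lub_finite_compacts:
  assumes "partial_order L" and f: "f \<in> carrier L"
    and sups: "\<And>x M. \<lbrakk>x \<in> carrier L; finite M; M \<subseteq> down L x; M \<noteq> {} \<or> e\<rbrakk>
                 \<Longrightarrow> \<exists>g. is_lub (L\<lparr>carrier := down L x\<rparr>) g M"
    and M: "finite M" "M \<subseteq> compacts L" "M \<subseteq> down L f" "M \<noteq> {} \<or> e"
    and g: "is_lub (L\<lparr>carrier := down L f\<rparr>) g M"
  shows "g \<in> compacts L"
proof -
  interpret partial_order L by fact
  have gL: "g \<in> carrier L" and gf: "g \<sqsubseteq>\<^bsub>L\<^esub> f" and Mg: "\<And>m. m \<in> M \<Longrightarrow> m \<sqsubseteq>\<^bsub>L\<^esub> g"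
    and least_g: "\<And>u. \<lbrakk>u \<in> carrier L; u \<sqsubseteq>\<^bsub>L\<^esub> f; \<forall>m\<in>M. m \<sqsubseteq>\<^bsub>L\<^esub> u\<rbrakk> \<Longrightarrow> g \<sqsubseteq>\<^bsub>L\<^esub> u"
    using g unfolding is_lub_down_iff[OF M(3)] by simp_all
  have MC: "m \<in> carrier L" "way_below L m m" if "m \<in> M" for m
    using that M(2) by (auto simp: compacts_def)
  have "\<exists>d\<in>D. g \<sqsubseteq>\<^bsub>L\<^esub> d" if D: "directed L D" "is_lub L s D" and gs: "g \<sqsubseteq>\<^bsub>L\<^esub> s" for D s
  proof -
    have DL: "D \<subseteq> carrier L" using D(1) by (simp add: directed_def)
    have s: "s \<in> carrier L" "\<And>d. d \<in> D \<Longrightarrow> d \<sqsubseteq>\<^bsub>L\<^esub> s" using D(2) by (simp_all add: is_lub_iff[OF DL])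
    have Ms: "m \<sqsubseteq>\<^bsub>L\<^esub> s" if "m \<in> M" for m
      using le_trans[OF Mg[OF that] gs] MC[OF that] gL s(1) by simp
    have "\<forall>m\<in>M. \<exists>d. d \<in> D \<and> m \<sqsubseteq>\<^bsub>L\<^esub> d"
      using MC(2) Ms D unfolding way_below_def by blast
    then obtain c where c: "\<forall>m\<in>M. c m \<in> D \<and> m \<sqsubseteq>\<^bsub>L\<^esub> c m" by (rule bchoice[THEN exE])
    then have "finite (c ` M)" "c ` M \<subseteq> D" using M(1) by auto
    then obtain d where d: "d \<in> D" "\<forall>x\<in>c ` M. x \<sqsubseteq>\<^bsub>L\<^esub> d"
      using directed_finite_bound[OF assms(1) D(1)] by blast
    have dL: "d \<in> carrier L" using d(1) DL by blast
    have Md: "m \<sqsubseteq>\<^bsub>L\<^esub> d" if "m \<in> M" for m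
      using le_trans[of m "c m" d] that c d(2) dL DL MC(1)[OF that] by blast
    have sub: "M \<subseteq> down L d" "M \<subseteq> down L s" using Md Ms MC(1) by (auto simp: down_def)
    obtain g' where g': "is_lub (L\<lparr>carrier := down L d\<rparr>) g' M"
      using sups[OF dL M(1) sub(1) M(4)] by blast
    obtain h where h: "is_lub (L\<lparr>carrier := down L s\<rparr>) h M"
      using sups[OF s(1) M(1) sub(2) M(4)] by blast
    note g' = g'[unfolded is_lub_down_iff[OF sub(1)]] and h = h[unfolded is_lub_down_iff[OF sub(2)]]
    have "g' \<sqsubseteq>\<^bsub>L\<^esub> s" using le_trans[of g' d s] g' s d(1) dL by simp
    then have hg': "h \<sqsubseteq>\<^bsub>L\<^esub> g'" using h g' by simp
    have "h \<sqsubseteq>\<^bsub>L\<^esub> g" using h gs gL Mg by simp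
    then have "h \<sqsubseteq>\<^bsub>L\<^esub> f" using le_trans[of h g f] h gf gL f by simp
    then have "g \<sqsubseteq>\<^bsub>L\<^esub> h" using least_g[of h] h by simp
    then have "g \<sqsubseteq>\<^bsub>L\<^esub> g'" using le_trans[of g h g'] hg' h g' gL by simp
    then have "g \<sqsubseteq>\<^bsub>L\<^esub> d" using le_trans[of g g' d] g' gL dL by simp
    with d(1) show ?thesis by blast
  qed
  with gL show ?thesis by (auto simp: compacts_def way_below_def)
qed

context based_domain
begin

abbreviation "S \<equiv> basis_space L B"

lemma S_simps: "points S = B" "fam S = (\<lambda>b. {b}) ` B"
  "rel S = {(a, b). a \<in> B \<and> b \<in> B \<and> a \<lless> b}"
  by (simp_all add: basis_space_def)

lemma upper_approx_S: "A \<subseteq> B \<Longrightarrow> upper_approx S A = {x \<in> B. \<exists>y\<in>A. x \<lless> y}"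
  unfolding upper_approx_def S_simps by blast

lemma upper_approx_single: "b \<in> B \<Longrightarrow> upper_approx S {b} = {x \<in> B. x \<lless> b}"
  by (simp add: upper_approx_S)

lemma B_nonempty: "B \<noteq> {}"
proof -
  obtain x where "x \<in> carrier L" using dcpo by (auto simp: dcpo_def)
  from basis_directed[OF this] show ?thesis by (auto simp: directed_def)
qed

lemma CF_space_S: "CF_space S"
  unfolding CF_space_def S_simps
proof (intro conjI ballI allI impI)
  show "trans {(a, b). a \<in> B \<and> b \<in> B \<and> a \<lless> b}" using wb_trans by (auto intro!: transI)
  show "(\<lambda>b. {b}) ` B \<noteq> {}" using B_nonempty by simp
  fix F K assume "F \<in> (\<lambda>b. {b}) ` B" "finite K \<and> K \<subseteq> upper_approx S F"
  then obtain b where b: "b \<in> B" "F = {b}" "finite K" "K \<subseteq> {x \<in> B. x \<lless> b}"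
    using upper_approx_single by auto
  then obtain c where c: "c \<in> B" "c \<lless> b" "\<forall>k\<in>K. k \<lless> c"
    using interpolation[of K b] B_carrier by blast
  show "\<exists>G\<in>(\<lambda>b. {b}) ` B. K \<subseteq> upper_approx S G \<and> G \<subseteq> upper_approx S F"
  proof (rule bexI[of _ "{c}"])
    show "K \<subseteq> upper_approx S {c} \<and> {c} \<subseteq> upper_approx S F"
      using b c upper_approx_single[OF c(1)] upper_approx_single[OF b(1)] by auto
  qed (use c in simp)
qed auto

sublocale S: cf_space S
  by unfold_locales (rule CF_space_S)

text \<open>An element is determined by the basis elements way below it, so inclusion of
  approximations is the order of \<open>L\<close>. This turns (sL-1), (sL-2) and (sL-2') into
  statements about upper bounds.\<close>

lemma upper_approx_subset_iff:
  assumes "M \<subseteq> B" "g \<in> B"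
  shows "upper_approx S M \<subseteq> upper_approx S {g} \<longleftrightarrow> (\<forall>m\<in>M. m \<sqsubseteq> g)"
proof -
  have "m \<sqsubseteq> g \<longleftrightarrow> (\<forall>b\<in>B. b \<lless> m \<longrightarrow> b \<lless> g)" if "m \<in> M" for m
    using that assms B_carrier by (intro le_iff_basis) auto
  then show ?thesis
    unfolding upper_approx_S[OF assms(1)] upper_approx_single[OF assms(2)] by blast
qed

lemma relative_sup:
  assumes "M \<subseteq> B" "M \<subseteq> down L f" "f \<in> B" "g \<in> B" "is_lub (L\<lparr>carrier := down L f\<rparr>) g M"
  shows "sL1 S M {f} {g}" "sL2 S M {f} {g}"
  using assms(5) B_carrier assms(1,3,4) unfolding is_lub_down_iff[OF assms(2)]
  by (auto simp: sL1_def sL2_def S_simps upper_approx_subset_iff)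

lemma global_sup:
  assumes "M \<subseteq> B" "M \<subseteq> down L f" "f \<in> B" "g \<in> B" "is_lub L g M"
  shows "sL1 S M {f} {g}" "sL2' S M {g}"
proof -
  have M: "M \<subseteq> carrier L" using assms(1) B_carrier by blast
  show "sL1 S M {f} {g}" "sL2' S M {g}"
    using assms(2,5) B_carrier assms(1,3,4) unfolding is_lub_iff[OF M]
    by (auto simp: sL1_def sL2'_def S_simps upper_approx_subset_iff down_def)
qed

lemma Union_fam_S:
  assumes "T \<subseteq> fam S" "finite T"
  shows "finite (\<Union>T)" "\<Union>T \<subseteq> B" "T \<noteq> {} \<Longrightarrow> \<Union>T \<noteq> {}"
  using assms by (auto simp: S_simps)

lemma upper_approx_single_down: "f \<in> B \<Longrightarrow> upper_approx S {f} \<subseteq> down L f"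
  using B_carrier wb_le by (auto simp: upper_approx_single down_def)

lemma local_sups_S:
  assumes sups: "\<And>f M. \<lbrakk>f \<in> B; finite M; M \<subseteq> B; M \<subseteq> down L f; M \<noteq> {} \<or> e\<rbrakk>
                   \<Longrightarrow> \<exists>g\<in>B. is_lub (L\<lparr>carrier := down L f\<rparr>) g M"
  shows "local_sups e S"
  unfolding local_sups_def
proof (intro conjI CF_space_S allI impI)
  fix T F assume T: "finite T \<and> T \<subseteq> fam S \<and> (T \<noteq> {} \<or> e) \<and> F \<in> fam S \<and> \<Union>T \<subseteq> upper_approx S F"
  then obtain f where f: "f \<in> B" "F = {f}" by (auto simp: S_simps)
  have M: "finite (\<Union>T)" "\<Union>T \<subseteq> B" "\<Union>T \<noteq> {} \<or> e" using T Union_fam_S[of T] by blast+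
  have d: "\<Union>T \<subseteq> down L f" using T f upper_approx_single_down by blast
  from sups[OF f(1) M(1,2) d M(3)] obtain g
    where g: "g \<in> B" "is_lub (L\<lparr>carrier := down L f\<rparr>) g (\<Union>T)" by blast
  from relative_sup[OF M(2) d f(1) g] f(2) g(1)
  show "\<exists>G\<in>fam S. sL1 S (\<Union>T) F G \<and> sL2 S (\<Union>T) F G" by (auto simp: S_simps)
qed

text \<open>A relative join must itself be a basis element. This is trivial if the basis is all of
  \<open>L\<close>; for the compact elements it is \<open>lub_finite_compacts\<close>.\<close>

lemma local_sups_S_compacts:
  assumes B: "B = carrier L \<or> B = compacts L"
    and sups: "\<And>x M. \<lbrakk>x \<in> carrier L; finite M; M \<subseteq> down L x; M \<noteq> {} \<or> e\<rbrakk>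
                 \<Longrightarrow> \<exists>g. is_lub (L\<lparr>carrier := down L x\<rparr>) g M"
  shows "local_sups e S"
proof (rule local_sups_S)
  fix f M assume M: "f \<in> B" "finite M" "M \<subseteq> B" "M \<subseteq> down L f" "M \<noteq> {} \<or> e"
  have f: "f \<in> carrier L" using M(1) B_carrier by blast
  obtain g where g: "is_lub (L\<lparr>carrier := down L f\<rparr>) g M" using sups[OF f M(2,4,5)] by blast
  have "g \<in> carrier L" using g unfolding is_lub_down_iff[OF M(4)] by simp
  moreover have "g \<in> compacts L" if "B = compacts L"
    using lub_finite_compacts[OF partial_order_axioms f sups M(2) _ M(4,5) g] M(3) that by simp
  ultimately show "\<exists>g\<in>B. is_lub (L\<lparr>carrier := down L f\<rparr>) g M" using g B by blast
qed

lemma sL_space_S: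
  assumes B: "B = carrier L \<or> B = compacts L" and L: "sL_domain L"
  shows "sL_space S"
  unfolding sL_space_iff
proof (rule local_sups_S_compacts[OF B])
  fix x M assume M: "x \<in> carrier L" "finite M" "M \<subseteq> down L x" "M \<noteq> {} \<or> False"
  interpret D: upper_semilattice "L\<lparr>carrier := down L x\<rparr>" using L M(1) by (simp add: sL_domain_def)
  show "\<exists>g. is_lub (L\<lparr>carrier := down L x\<rparr>) g M"
    using D.finite_sup_least[of M] M by auto
qed

lemma L_space_S:
  assumes B: "B = carrier L \<or> B = compacts L" and L: "L_domain L"
  shows "L_space S"
  unfolding L_space_iff
proof (rule local_sups_S_compacts[OF B])
  fix x M assume M: "x \<in> carrier L" "finite M" "M \<subseteq> down L x" "M \<noteq> {} \<or> True"
  interpret D: complete_lattice "L\<lparr>carrier := down L x\<rparr>" using L M(1) by (simp add: L_domain_def)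
  show "\<exists>g. is_lub (L\<lparr>carrier := down L x\<rparr>) g M"
    using D.sup_exists[of M] M by simp
qed

lemma bc_space_S:
  assumes B: "B = carrier L" and L: "bc_domain L"
  shows "bc_space S"
  unfolding bc_space_iff
proof (intro conjI CF_space_S allI impI)
  fix T F assume T: "finite T \<and> T \<subseteq> fam S \<and> F \<in> fam S \<and> \<Union>T \<subseteq> upper_approx S F"
  then obtain f where f: "f \<in> B" "F = {f}" by (auto simp: S_simps)
  have M: "\<Union>T \<subseteq> B" using T Union_fam_S[of T] by blast
  have d: "\<Union>T \<subseteq> down L f" using T f upper_approx_single_down by blast
  then have "f \<in> Upper L (\<Union>T)" using f(1) B_carrier by (auto simp: Upper_def down_def)
  then have "\<exists>g. is_lub L g (\<Union>T)" using L M B unfolding bc_domain_def by blast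
  then obtain g where g: "is_lub L g (\<Union>T)" by blast
  then have "g \<in> B" using B by (auto simp: least_def Upper_def)
  from global_sup[OF M d f(1) this g] f(2) this
  show "\<exists>G\<in>fam S. sL1 S (\<Union>T) F G \<and> sL2' S (\<Union>T) G" by (auto simp: S_simps)
qed

text \<open>Compact elements are exactly those related to themselves by way-below, which is the
  reflexivity required here.\<close>

lemma topological_S:
  assumes "B = compacts L"
  shows "topological S"
proof -
  have "b \<lless> b" if "b \<in> B" for b using that assms by (simp add: compacts_def)
  then show ?thesis
    using S.trans_rel unfolding topological_def preorder_on_def S_simps
    by (auto simp: refl_on_def)
qed

section \<open>The domain as ideal completion of its basis space\<close>

lemma mem_approximants: "{b} \<in> approximants L B x \<longleftrightarrow> b \<in> B \<and> b \<lless> x"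
  by (auto simp: approximants_def)

lemma approximants_subset_iff:
  assumes "x \<in> carrier L" "y \<in> carrier L"
  shows "approximants L B x \<subseteq> approximants L B y \<longleftrightarrow> x \<sqsubseteq> y"
  unfolding le_iff_basis[OF assms] by (auto simp: approximants_def)

lemma approximants_rounded:
  assumes x: "x \<in> carrier L"
  shows "approximants L B x \<in> rounded_ideals S"
  unfolding rounded_ideals_def mem_Collect_eq
proof (intro conjI allI impI ballI)
  show "approximants L B x \<subseteq> fam S" by (auto simp: approximants_def S_simps)
next
  fix T assume T: "finite T \<and> T \<subseteq> approximants L B x"
  then have K: "finite (\<Union>T)" "\<And>k. k \<in> \<Union>T \<Longrightarrow> k \<lless> x" "\<Union>T \<subseteq> B"
    by (auto simp: approximants_def)
  from interpolation[OF K(1) x K(2)] obtain b where b: "b \<in> B" "b \<lless> x" "\<forall>k\<in>\<Union>T. k \<lless> b" by blast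
  then have "\<forall>N\<in>T. N \<subseteq> upper_approx S {b}"
    using K(3) by (auto simp: upper_approx_single)
  moreover have "{b} \<in> approximants L B x" using b by (simp add: mem_approximants)
  ultimately show "\<exists>F\<in>approximants L B x. \<forall>N\<in>T. N \<subseteq> upper_approx S F" by blast
next
  fix F G assume F: "F \<in> approximants L B x" "G \<in> fam S" "G \<subseteq> upper_approx S F"
  then obtain a b where ab: "F = {a}" "a \<in> B" "a \<lless> x" "G = {b}" "b \<in> B"
    by (auto simp: approximants_def S_simps)
  with F(3) have "b \<lless> a" by (simp add: upper_approx_single)
  with ab show "G \<in> approximants L B x" using wb_trans[of b a x] by (simp add: mem_approximants)
qed

text \<open>The element is the supremum of the basis elements whose singletons lie in
  \<open>I\<close>; roundedness of \<open>I\<close> makes all of them way below it.\<close>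

lemma rounded_approximants:
  assumes I: "I \<in> rounded_ideals S"
  shows "\<exists>x\<in>carrier L. approximants L B x = I"
proof -
  have IB: "I \<subseteq> (\<lambda>b. {b}) ` B" using S.ideal_fam[OF I] by (simp add: S_simps)
  have wb: "a \<lless> b" if "{a} \<subseteq> upper_approx S {b}" "{b} \<in> I" for a b
    using that IB by (auto simp: upper_approx_single)
  let ?D = "{b. {b} \<in> I}"
  have DL: "?D \<subseteq> carrier L" using IB B_carrier by auto
  have D: "directed L ?D"
    unfolding directed_def
  proof (intro conjI ballI DL)
    show "?D \<noteq> {}" using S.ideal_nonempty[OF I] IB by auto
    fix x y assume "x \<in> ?D" "y \<in> ?D"
    then obtain H where "H \<in> I" "{x} \<subseteq> upper_approx S H" "{y} \<subseteq> upper_approx S H"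
      using S.ideal_bound2[OF I, of "{x}" "{y}"] by auto
    moreover from this IB obtain c where "H = {c}" by blast
    ultimately have "{c} \<in> I" "x \<lless> c" "y \<lless> c" using wb by simp_all
    then show "\<exists>z\<in>?D. x \<sqsubseteq> z \<and> y \<sqsubseteq> z" using wb_le by blast
  qed
  then obtain x where x: "is_lub L x ?D" using dcpo by (auto simp: dcpo_def)
  note x' = x[unfolded is_lub_iff[OF DL]]
  have "{b} \<in> I \<longleftrightarrow> b \<in> B \<and> b \<lless> x" for b
  proof
    assume b: "{b} \<in> I"
    then obtain H where H: "H \<in> I" "{b} \<subseteq> upper_approx S H"
      using S.ideal_mem_iff[OF I, of "{b}"] by blast
    moreover from this IB obtain c where "H = {c}" by blast
    ultimately have "b \<lless> c" "c \<in> ?D" using wb by auto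
    then have "b \<lless> x" using wb_le_trans[of b c x] x' by simp
    with b IB show "b \<in> B \<and> b \<lless> x" by auto
  next
    assume b: "b \<in> B \<and> b \<lless> x"
    \<comment> \<open>Way-below only yields \<open>b \<sqsubseteq> c\<close>. A further member
      \<open>{d}\<close> with \<open>c \<lless> d\<close> is needed to put \<open>{b}\<close> in an
      approximation.\<close>
    then obtain c where c: "{c} \<in> I" "b \<sqsubseteq> c"
      using D x x' le_refl[of x] unfolding way_below_def by blast
    then obtain H where H: "H \<in> I" "{c} \<subseteq> upper_approx S H"
      using S.ideal_mem_iff[OF I, of "{c}"] by blast
    moreover from this IB obtain d where d: "H = {d}" "d \<in> B" by blast
    ultimately have "c \<lless> d" using wb by simp
    then have "b \<lless> d" using le_wb_trans[of b c d] c b B_carrier by blast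
    then show "{b} \<in> I"
      using S.ideal_down[OF I H(1), of "{b}"] b d by (simp add: S_simps upper_approx_single)
  qed
  then have "approximants L B x = I" using IB by (auto simp: approximants_def)
  with x' show ?thesis by blast
qed

lemma ideal_completion_S: "ideal_completion S L (approximants L B)"
proof
  show "bij_betw (approximants L B) (carrier L) (rounded_ideals S)"
    unfolding bij_betw_def
  proof
    show "inj_on (approximants L B) (carrier L)"
    proof (rule inj_onI)
      fix x y assume "x \<in> carrier L" "y \<in> carrier L" "approximants L B x = approximants L B y"
      then show "x = y"
        using approximants_subset_iff[of x y] approximants_subset_iff[of y x] by (intro le_antisym) auto
    qed
    show "approximants L B ` carrier L = rounded_ideals S"
      using approximants_rounded rounded_approximants by blast
  qed
  show "(.=) = (=)" by (rule eq_is_equal)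
  show "x \<sqsubseteq> y \<longleftrightarrow> approximants L B x \<subseteq> approximants L B y"
    if "x \<in> carrier L" "y \<in> carrier L" for x y
    using that by (simp add: approximants_subset_iff)
qed

end

section \<open>Approximable relations and Scott continuous maps\<close>

definition id_rel :: "'a space \<Rightarrow> ('a set \<times> 'a set) set" where
  "id_rel X = {(F, G). F \<in> fam X \<and> G \<in> fam X \<and> G \<subseteq> upper_approx X F}"

text \<open>A rule form of the definition: memberships in the families are collected in the first
  premise, and the union in condition (5) is split.\<close>

lemma CF_approximableI:
  assumes "\<And>F G. (F, G) \<in> \<Theta> \<Longrightarrow> F \<in> fam X \<and> G \<in> fam Y"
    and "\<And>F. F \<in> fam X \<Longrightarrow> \<exists>G. (F, G) \<in> \<Theta>"
    and "\<And>F F' G. \<lbrakk>F' \<in> fam X; F \<subseteq> upper_approx X F'; (F, G) \<in> \<Theta>\<rbrakk> \<Longrightarrow> (F', G) \<in> \<Theta>"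
    and "\<And>F G G'. \<lbrakk>G' \<in> fam Y; G' \<subseteq> upper_approx Y G; (F, G) \<in> \<Theta>\<rbrakk> \<Longrightarrow> (F, G') \<in> \<Theta>"
    and "\<And>F G. (F, G) \<in> \<Theta> \<Longrightarrow>
           \<exists>F' G'. F' \<subseteq> upper_approx X F \<and> G \<subseteq> upper_approx Y G' \<and> (F', G') \<in> \<Theta>"
    and "\<And>F G1 G2. \<lbrakk>(F, G1) \<in> \<Theta>; (F, G2) \<in> \<Theta>\<rbrakk> \<Longrightarrow>
           \<exists>G3. G1 \<subseteq> upper_approx Y G3 \<and> G2 \<subseteq> upper_approx Y G3 \<and> (F, G3) \<in> \<Theta>"
  shows "CF_approximable X Y \<Theta>"
  unfolding CF_approximable_def
proof (intro conjI ballI allI impI)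
  show "\<Theta> \<subseteq> fam X \<times> fam Y" using assms(1) by auto
  show "\<exists>G\<in>fam Y. (F, G) \<in> \<Theta>" if "F \<in> fam X" for F
    using assms(1,2) that by blast
  show "(F', G) \<in> \<Theta>" if "F' \<in> fam X" "F \<subseteq> upper_approx X F' \<and> (F, G) \<in> \<Theta>" for F F' G
    using assms(3) that by blast
  show "(F, G') \<in> \<Theta>" if "G' \<in> fam Y" "(F, G) \<in> \<Theta> \<and> G' \<subseteq> upper_approx Y G" for F G G'
    using assms(4) that by blast
  show "\<exists>F'\<in>fam X. \<exists>G'\<in>fam Y. F' \<subseteq> upper_approx X F \<and> G \<subseteq> upper_approx Y G' \<and> (F', G') \<in> \<Theta>"
    if "(F, G) \<in> \<Theta>" for F G
    using assms(5)[OF that] assms(1) by blast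
  show "\<exists>G3\<in>fam Y. G1 \<union> G2 \<subseteq> upper_approx Y G3 \<and> (F, G3) \<in> \<Theta>"
    if "(F, G1) \<in> \<Theta> \<and> (F, G2) \<in> \<Theta>" for F G1 G2
    using assms(6)[of F G1 G2] that assms(1) by auto
qed

lemma CF_approximableD:
  assumes "CF_approximable X Y \<Theta>"
  shows "(F, G) \<in> \<Theta> \<Longrightarrow> F \<in> fam X" "(F, G) \<in> \<Theta> \<Longrightarrow> G \<in> fam Y"
    and "F \<in> fam X \<Longrightarrow> \<exists>G. (F, G) \<in> \<Theta>"
    and "\<lbrakk>F' \<in> fam X; F \<subseteq> upper_approx X F'; (F, G) \<in> \<Theta>\<rbrakk> \<Longrightarrow> (F', G) \<in> \<Theta>"
    and "\<lbrakk>G' \<in> fam Y; G' \<subseteq> upper_approx Y G; (F, G) \<in> \<Theta>\<rbrakk> \<Longrightarrow> (F, G') \<in> \<Theta>"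
    and "(F, G) \<in> \<Theta> \<Longrightarrow>
           \<exists>F' G'. F' \<subseteq> upper_approx X F \<and> G \<subseteq> upper_approx Y G' \<and> (F', G') \<in> \<Theta>"
    and "\<lbrakk>(F, G1) \<in> \<Theta>; (F, G2) \<in> \<Theta>\<rbrakk> \<Longrightarrow>
           \<exists>G3. G1 \<subseteq> upper_approx Y G3 \<and> G2 \<subseteq> upper_approx Y G3 \<and> (F, G3) \<in> \<Theta>"
proof -
  note a = assms[unfolded CF_approximable_def]
  from a have "\<Theta> \<subseteq> fam X \<times> fam Y" by (elim conjE)
  then show fam: "(F, G) \<in> \<Theta> \<Longrightarrow> F \<in> fam X" "(F, G) \<in> \<Theta> \<Longrightarrow> G \<in> fam Y" for F G by auto
  from a have 1: "\<forall>F\<in>fam X. \<exists>G\<in>fam Y. (F, G) \<in> \<Theta>" by (elim conjE)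
  then show "F \<in> fam X \<Longrightarrow> \<exists>G. (F, G) \<in> \<Theta>" by auto
  from a have 2: "\<forall>F\<in>fam X. \<forall>F'\<in>fam X. \<forall>G\<in>fam Y.
        F \<subseteq> upper_approx X F' \<and> (F, G) \<in> \<Theta> \<longrightarrow> (F', G) \<in> \<Theta>" by (elim conjE)
  show "(F', G) \<in> \<Theta>" if "F' \<in> fam X" "F \<subseteq> upper_approx X F'" "(F, G) \<in> \<Theta>"
    by (rule 2[rule_format, of F F' G]) (use that in \<open>auto intro: fam\<close>)
  from a have 3: "\<forall>F\<in>fam X. \<forall>G\<in>fam Y. \<forall>G'\<in>fam Y.
        (F, G) \<in> \<Theta> \<and> G' \<subseteq> upper_approx Y G \<longrightarrow> (F, G') \<in> \<Theta>" by (elim conjE)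
  show "(F, G') \<in> \<Theta>" if "G' \<in> fam Y" "G' \<subseteq> upper_approx Y G" "(F, G) \<in> \<Theta>"
    by (rule 3[rule_format, of F G G']) (use that in \<open>auto intro: fam\<close>)
  from a have 4: "\<forall>F G. (F, G) \<in> \<Theta> \<longrightarrow> (\<exists>F'\<in>fam X. \<exists>G'\<in>fam Y.
        F' \<subseteq> upper_approx X F \<and> G \<subseteq> upper_approx Y G' \<and> (F', G') \<in> \<Theta>)" by (elim conjE)
  show "\<exists>F' G'. F' \<subseteq> upper_approx X F \<and> G \<subseteq> upper_approx Y G' \<and> (F', G') \<in> \<Theta>"
    if "(F, G) \<in> \<Theta>"
    using 4[rule_format, OF that] by auto
  from a have 5: "\<forall>F G1 G2. (F, G1) \<in> \<Theta> \<and> (F, G2) \<in> \<Theta> \<longrightarrow>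
        (\<exists>G3\<in>fam Y. G1 \<union> G2 \<subseteq> upper_approx Y G3 \<and> (F, G3) \<in> \<Theta>)" by (elim conjE)
  show "\<exists>G3. G1 \<subseteq> upper_approx Y G3 \<and> G2 \<subseteq> upper_approx Y G3 \<and> (F, G3) \<in> \<Theta>"
    if "(F, G1) \<in> \<Theta>" "(F, G2) \<in> \<Theta>"
    using 5[rule_format, of F G1 G2] that by auto
qed

lemma (in cf_space) id_rel_approximable: "CF_approximable X X (id_rel X)"
proof (rule CF_approximableI)
  have interp: "\<exists>K\<in>fam X. G1 \<subseteq> U K \<and> G2 \<subseteq> U K \<and> K \<subseteq> U F"
    if "F \<in> fam X" "G1 \<in> fam X" "G2 \<in> fam X" "G1 \<subseteq> U F" "G2 \<subseteq> U F" for F G1 G2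
    using fam_interpolation[OF that(1), of "{G1, G2}"] that(2-5) by auto
  show "\<exists>G. (F, G) \<in> id_rel X" if "F \<in> fam X" for F
    using CF_interpolation[OF that, of "{}"] that by (auto simp: id_rel_def)
  show "(F', G) \<in> id_rel X" if "F' \<in> fam X" "F \<subseteq> U F'" "(F, G) \<in> id_rel X" for F F' G
    using that below_trans[of G F F'] by (simp add: id_rel_def)
  show "(F, G') \<in> id_rel X" if "G' \<in> fam X" "G' \<subseteq> U G" "(F, G) \<in> id_rel X" for F G G'
    using that below_trans[of G' G F] by (simp add: id_rel_def)
  show "\<exists>F' G'. F' \<subseteq> U F \<and> G \<subseteq> U G' \<and> (F', G') \<in> id_rel X" if FG: "(F, G) \<in> id_rel X" for F G
  proof -
    \<comment> \<open>Condition (4) asks for a related pair strictly between \<open>G\<close> and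
      \<open>F\<close>, hence for two interpolants in the chain \<open>G\<close>, \<open>K'\<close>,
      \<open>K\<close>, \<open>F\<close>.\<close>
    obtain K where K: "K \<in> fam X" "G \<subseteq> U K" "K \<subseteq> U F"
      using interp[of F G G] FG by (auto simp: id_rel_def)
    moreover obtain K' where "K' \<in> fam X" "G \<subseteq> U K'" "K' \<subseteq> U K"
      using interp[of K G G] K FG by (auto simp: id_rel_def)
    ultimately have "K \<subseteq> U F" "G \<subseteq> U K'" "(K, K') \<in> id_rel X" by (simp_all add: id_rel_def)
    then show ?thesis by blast
  qed
  show "\<exists>G3. G1 \<subseteq> U G3 \<and> G2 \<subseteq> U G3 \<and> (F, G3) \<in> id_rel X"
    if "(F, G1) \<in> id_rel X" "(F, G2) \<in> id_rel X" for F G1 G2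
    using interp[of F G1 G2] that by (auto simp: id_rel_def)
qed (auto simp: id_rel_def)

lemma relcomp_approximable:
  assumes T: "CF_approximable X Y \<Theta>" and V: "CF_approximable Y Z \<Upsilon>"
  shows "CF_approximable X Z (\<Theta> O \<Upsilon>)"
proof (rule CF_approximableI)
  note T = CF_approximableD[OF T] and V = CF_approximableD[OF V]
  show "F \<in> fam X \<and> H \<in> fam Z" if "(F, H) \<in> \<Theta> O \<Upsilon>" for F H
    using that T(1) V(2) by blast
  show "\<exists>H. (F, H) \<in> \<Theta> O \<Upsilon>" if "F \<in> fam X" for F
    using T(3)[OF that] T(2) V(3) by blast
  show "(F', H) \<in> \<Theta> O \<Upsilon>"
    if "F' \<in> fam X" "F \<subseteq> upper_approx X F'" "(F, H) \<in> \<Theta> O \<Upsilon>" for F F' H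
    using that(3) T(4)[OF that(1,2)] by blast
  show "(F, H') \<in> \<Theta> O \<Upsilon>"
    if "H' \<in> fam Z" "H' \<subseteq> upper_approx Z H" "(F, H) \<in> \<Theta> O \<Upsilon>" for F H H'
    using that(3) V(5)[OF that(1,2)] by blast
  show "\<exists>F' H'. F' \<subseteq> upper_approx X F \<and> H \<subseteq> upper_approx Z H' \<and> (F', H') \<in> \<Theta> O \<Upsilon>"
    if FH: "(F, H) \<in> \<Theta> O \<Upsilon>" for F H
  proof -
    obtain G where G: "(F, G) \<in> \<Theta>" "(G, H) \<in> \<Upsilon>" using FH by blast
    obtain F' G' where 1: "F' \<subseteq> upper_approx X F" "G \<subseteq> upper_approx Y G'" "(F', G') \<in> \<Theta>"
      using T(6)[OF G(1)] by blast
    \<comment> \<open>By condition (2) the larger \<open>G'\<close> still reaches \<open>H\<close>.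
      Splitting this pair by (4) gives a smaller \<open>G''\<close>, which \<open>F'\<close> still
      reaches by (3).\<close>
    have G'H: "(G', H) \<in> \<Upsilon>" using V(4)[OF T(2)[OF 1(3)] 1(2) G(2)] .
    obtain G'' H' where 2: "G'' \<subseteq> upper_approx Y G'" "H \<subseteq> upper_approx Z H'" "(G'', H') \<in> \<Upsilon>"
      using V(6)[OF G'H] by blast
    have "(F', G'') \<in> \<Theta>" using T(5)[OF V(1)[OF 2(3)] 2(1) 1(3)] .
    with 1(1) 2(2,3) show ?thesis by blast
  qed
  show "\<exists>H3. H1 \<subseteq> upper_approx Z H3 \<and> H2 \<subseteq> upper_approx Z H3 \<and> (F, H3) \<in> \<Theta> O \<Upsilon>"
    if H: "(F, H1) \<in> \<Theta> O \<Upsilon>" "(F, H2) \<in> \<Theta> O \<Upsilon>" for F H1 H2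
  proof -
    obtain G1 G2 where G: "(F, G1) \<in> \<Theta>" "(G1, H1) \<in> \<Upsilon>" "(F, G2) \<in> \<Theta>" "(G2, H2) \<in> \<Upsilon>"
      using H by blast
    obtain G3 where 3: "G1 \<subseteq> upper_approx Y G3" "G2 \<subseteq> upper_approx Y G3" "(F, G3) \<in> \<Theta>"
      using T(7)[OF G(1,3)] by blast
    have "(G3, H1) \<in> \<Upsilon>" "(G3, H2) \<in> \<Upsilon>"
      using V(4)[OF T(2)[OF 3(3)] 3(1) G(2)] V(4)[OF T(2)[OF 3(3)] 3(2) G(4)] .
    with V(7)[OF this] 3(3) show ?thesis by blast
  qed
qed

lemma (in cf_space) id_rel_Image:
  assumes "I \<in> rounded_ideals X"
  shows "id_rel X `` I = I"
proof (rule Set.set_eqI)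
  fix G
  have "G \<in> id_rel X `` I \<longleftrightarrow> G \<in> fam X \<and> (\<exists>F\<in>I. G \<subseteq> U F)"
    using ideal_fam[OF assms] by (auto simp: id_rel_def)
  also have "\<dots> \<longleftrightarrow> G \<in> I" by (rule ideal_mem_iff[OF assms, symmetric])
  finally show "G \<in> id_rel X `` I \<longleftrightarrow> G \<in> I" .
qed

text \<open>Finitely many values come from finitely many members of \<open>I\<close>; by condition
  (2) one common bound in \<open>I\<close> reaches all of them, and condition (5) bounds them.
  Condition (1) handles the empty set.\<close>

lemma approximable_Image_rounded:
  assumes "cf_space X" "cf_space Y" and T: "CF_approximable X Y \<Theta>" and I: "I \<in> rounded_ideals X"
  shows "\<Theta> `` I \<in> rounded_ideals Y"
proof -
  interpret X: cf_space X by fact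
  interpret Y: cf_space Y by fact
  note T = CF_approximableD[OF T]
  have bound: "\<exists>F G. F \<in> I \<and> (F, G) \<in> \<Theta> \<and> (\<forall>N\<in>S. N \<subseteq> Y.U G)" if "finite S" "S \<subseteq> \<Theta> `` I" for S
    using that
  proof (induction S rule: finite_induct)
    case empty
    then show ?case using X.ideal_nonempty[OF I] X.ideal_fam[OF I] T(3) by blast
  next
    case (insert N S)
    then obtain F G where 1: "F \<in> I" "(F, G) \<in> \<Theta>" "\<forall>N\<in>S. N \<subseteq> Y.U G" by auto
    from insert.prems obtain F' where 2: "F' \<in> I" "(F', N) \<in> \<Theta>" by auto
    obtain H where H: "H \<in> I" "F \<subseteq> X.U H" "F' \<subseteq> X.U H" using X.ideal_bound2[OF I 1(1) 2(1)] by blast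
    have "H \<in> fam X" using H(1) X.ideal_fam[OF I] by blast
    then have "(H, G) \<in> \<Theta>" "(H, N) \<in> \<Theta>" using T(4)[OF _ H(2) 1(2)] T(4)[OF _ H(3) 2(2)] by simp_all
    then obtain G3 where 3: "G \<subseteq> Y.U G3" "N \<subseteq> Y.U G3" "(H, G3) \<in> \<Theta>" using T(7) by metis
    have "M \<subseteq> Y.U G3" if "M \<in> insert N S" for M
      using that 1(3) 3(2) Y.below_trans[OF _ 3(1), of M] by blast
    with H(1) 3(3) show ?case by blast
  qed
  show ?thesis
    unfolding rounded_ideals_def mem_Collect_eq
  proof (intro conjI allI impI ballI)
    show "\<Theta> `` I \<subseteq> fam Y" using T(2) by blast
    show "\<exists>G\<in>\<Theta> `` I. \<forall>N\<in>S. N \<subseteq> Y.U G" if "finite S \<and> S \<subseteq> \<Theta> `` I" for S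
      using bound[of S] that by blast
    show "G' \<in> \<Theta> `` I" if "G \<in> \<Theta> `` I" "G' \<in> fam Y" "G' \<subseteq> Y.U G" for G G'
      using that(1) T(5)[OF that(2,3)] by blast
  qed
qed

text \<open>A relation is recovered from its action on principal ideals. Condition (4) replaces the
  source \<open>F\<close> by some \<open>F'\<close> in its principal ideal, and condition (2) leads
  back.\<close>

lemma approximable_eqI:
  assumes "cf_space X" and T: "CF_approximable X Y \<Theta>" and T': "CF_approximable X Y \<Theta>'"
    and eq: "\<And>I. I \<in> rounded_ideals X \<Longrightarrow> \<Theta> `` I = \<Theta>' `` I"
  shows "\<Theta> = \<Theta>'"
proof -
  interpret cf_space X by fact
  have mem: "(F, G) \<in> \<Theta> \<longleftrightarrow> F \<in> fam X \<and> G \<in> \<Theta> `` principal_ideal X F"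
    if "CF_approximable X Y \<Theta>" for F G \<Theta>
  proof
    note T = CF_approximableD[OF that]
    assume FG: "(F, G) \<in> \<Theta>"
    obtain F' G' where 1: "F' \<subseteq> U F" "G \<subseteq> upper_approx Y G'" "(F', G') \<in> \<Theta>"
      using T(6)[OF FG] by blast
    have "(F', G) \<in> \<Theta>" using T(5)[OF T(2)[OF FG] 1(2,3)] .
    moreover have "F' \<in> principal_ideal X F" using 1(1) T(1)[OF 1(3)] by (simp add: principal_ideal_def)
    ultimately show "F \<in> fam X \<and> G \<in> \<Theta> `` principal_ideal X F" using T(1)[OF FG] by blast
  next
    note T = CF_approximableD[OF that]
    assume "F \<in> fam X \<and> G \<in> \<Theta> `` principal_ideal X F"
    then obtain F' where "F \<in> fam X" "F' \<subseteq> U F" "(F', G) \<in> \<Theta>" by (auto simp: principal_ideal_def)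
    then show "(F, G) \<in> \<Theta>" by (rule T(4))
  qed
  have "(F, G) \<in> \<Theta> \<longleftrightarrow> (F, G) \<in> \<Theta>'" for F G
    using mem[OF T, of F G] mem[OF T', of F G] eq[OF principal_ideal_rounded, of F] by auto
  then show ?thesis by auto
qed

text \<open>\<open>F\<close> is related to \<open>G\<close> when \<open>G\<close> lies in the ideal
  of the value of \<open>f\<close> at the generator of \<open>F\<close>. That element is described
  by its ideal, so the definition makes sense outside \<open>ideal_completion\<close>.\<close>

definition rel_of_map ::
  "'a space \<Rightarrow> 'b gorder \<Rightarrow> ('b \<Rightarrow> 'a set set) \<Rightarrow> ('d \<Rightarrow> 'c set set) \<Rightarrow> ('b \<Rightarrow> 'd) \<Rightarrow> ('a set \<times> 'c set) set" where
  "rel_of_map X L \<kappa> \<mu> f =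
     {(F, G). F \<in> fam X \<and> (\<exists>x\<in>carrier L. \<kappa> x = principal_ideal X F \<and> G \<in> \<mu> (f x))}"

definition map_of_rel ::
  "'b gorder \<Rightarrow> ('b \<Rightarrow> 'a set set) \<Rightarrow> 'd gorder \<Rightarrow> ('d \<Rightarrow> 'c set set) \<Rightarrow> ('a set \<times> 'c set) set \<Rightarrow> 'b \<Rightarrow> 'd" where
  "map_of_rel L \<kappa> M \<mu> \<Theta> = (\<lambda>x\<in>carrier L. inv_into (carrier M) \<mu> (\<Theta> `` \<kappa> x))"

locale ideal_completions =
  X: ideal_completion X L \<kappa> + Y: ideal_completion Y M \<mu>
  for X :: "'a space" and L :: "'b gorder" and \<kappa> and Y :: "'c space" and M :: "'d gorder" and \<mu>
begin

lemma rel_of_map_mem: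
  "(F, G) \<in> rel_of_map X L \<kappa> \<mu> f \<longleftrightarrow> F \<in> fam X \<and> G \<in> \<mu> (f (X.generator F))"
proof -
  have "x = X.generator F" if "F \<in> fam X" "x \<in> carrier L" "\<kappa> x = principal_ideal X F" for x
    using X.kappa_eq_iff[OF that(2) X.generator(1)[OF that(1)]] that X.generator(2) by simp
  then show ?thesis
    using X.generator[of F] by (auto simp: rel_of_map_def)
qed

context
  fixes f assumes f: "scott_continuous L M f"
begin

lemma f_carrier: "x \<in> carrier L \<Longrightarrow> f x \<in> carrier M"
  using f by (auto simp: scott_continuous_def)

text \<open>This is where continuity enters: \<open>x\<close> is the directed supremum of its
  generators, and directed suprema in \<open>M\<close> are unions. Conditions (2) and (4) for
  \<open>rel_of_map\<close> both rest on it.\<close>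

lemma scott_image_Union:
  assumes x: "x \<in> carrier L"
  shows "\<mu> (f x) = (\<Union>F\<in>\<kappa> x. \<mu> (f (X.generator F)))"
proof -
  note D = X.generators_directed[OF x]
  have "directed M (f ` X.generator ` \<kappa> x)"
    by (rule directed_image[OF D(1)])
      (use f scott_continuous_mono[OF X.partial_order_axioms f] in \<open>auto simp: scott_continuous_def\<close>)
  moreover have "is_lub M (f x) (f ` X.generator ` \<kappa> x)"
    using f D by (simp add: scott_continuous_def)
  ultimately show ?thesis using Y.is_lub_directed_iff by auto
qed

text \<open>The relation of \<open>f\<close> acts on ideals as \<open>f\<close> acts on elements.
  Combined with \<open>approximable_eqI_elements\<close>, this reduces equations between relations
  to equations between maps.\<close>

lemma rel_of_map_Image:
  assumes "x \<in> carrier L"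
  shows "rel_of_map X L \<kappa> \<mu> f `` \<kappa> x = \<mu> (f x)"
  unfolding scott_image_Union[OF assms]
  using X.generator_le(1)[OF assms] by (auto simp: rel_of_map_mem Image_def)

lemma rel_of_map_approximable: "CF_approximable X Y (rel_of_map X L \<kappa> \<mu> f)"
proof (rule CF_approximableI)
  have J: "\<mu> (f (X.generator F)) \<in> rounded_ideals Y" if "F \<in> fam X" for F
    using that by (intro Y.rounded f_carrier X.generator)
  show "F \<in> fam X \<and> G \<in> fam Y" if "(F, G) \<in> rel_of_map X L \<kappa> \<mu> f" for F G
    using that Y.ideal_fam[OF J, of F] by (auto simp: rel_of_map_mem)
  show "\<exists>G. (F, G) \<in> rel_of_map X L \<kappa> \<mu> f" if "F \<in> fam X" for F
    using that Y.ideal_nonempty[OF J[OF that]] by (auto simp: rel_of_map_mem)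
  show "(F', G) \<in> rel_of_map X L \<kappa> \<mu> f"
    if "F' \<in> fam X" "F \<subseteq> X.U F'" "(F, G) \<in> rel_of_map X L \<kappa> \<mu> f" for F F' G
  proof -
    have F: "F \<in> fam X" "G \<in> \<mu> (f (X.generator F))" using that(3) by (simp_all add: rel_of_map_mem)
    have "F \<in> \<kappa> (X.generator F')"
      using that(1,2) F(1) by (simp add: X.generator principal_ideal_def)
    then show ?thesis
      using scott_image_Union[OF X.generator(1)[OF that(1)]] F(2) that(1) by (auto simp: rel_of_map_mem)
  qed
  show "(F, G') \<in> rel_of_map X L \<kappa> \<mu> f"
    if "G' \<in> fam Y" "G' \<subseteq> Y.U G" "(F, G) \<in> rel_of_map X L \<kappa> \<mu> f" for F G G'
    using that Y.ideal_down[OF J, of F G G'] by (simp add: rel_of_map_mem)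
  show "\<exists>F' G'. F' \<subseteq> X.U F \<and> G \<subseteq> Y.U G' \<and> (F', G') \<in> rel_of_map X L \<kappa> \<mu> f"
    if FG: "(F, G) \<in> rel_of_map X L \<kappa> \<mu> f" for F G
  proof -
    have F: "F \<in> fam X" "G \<in> \<mu> (f (X.generator F))" using FG by (simp_all add: rel_of_map_mem)
    obtain G' where G': "G' \<in> \<mu> (f (X.generator F))" "G \<subseteq> Y.U G'"
      using Y.ideal_bound2[OF J[OF F(1)] F(2) F(2)] by blast
    then obtain F' where "F' \<in> \<kappa> (X.generator F)" "G' \<in> \<mu> (f (X.generator F'))"
      using scott_image_Union[OF X.generator(1)[OF F(1)]] by auto
    then have "F' \<subseteq> X.U F" "(F', G') \<in> rel_of_map X L \<kappa> \<mu> f"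
      using F(1) by (simp_all add: rel_of_map_mem X.generator principal_ideal_def)
    with G'(2) show ?thesis by blast
  qed
  show "\<exists>G3. G1 \<subseteq> Y.U G3 \<and> G2 \<subseteq> Y.U G3 \<and> (F, G3) \<in> rel_of_map X L \<kappa> \<mu> f"
    if "(F, G1) \<in> rel_of_map X L \<kappa> \<mu> f" "(F, G2) \<in> rel_of_map X L \<kappa> \<mu> f" for F G1 G2
    using that Y.ideal_bound2[OF J, of F G1 G2] by (auto simp: rel_of_map_mem)
qed

end

context
  fixes \<Theta> assumes T: "CF_approximable X Y \<Theta>"
begin

lemma map_of_rel:
  assumes x: "x \<in> carrier L"
  shows "map_of_rel L \<kappa> M \<mu> \<Theta> x \<in> carrier M" "\<mu> (map_of_rel L \<kappa> M \<mu> \<Theta> x) = \<Theta> `` \<kappa> x"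
proof -
  have "\<Theta> `` \<kappa> x \<in> rounded_ideals Y"
    by (rule approximable_Image_rounded[OF X.cf_space_axioms Y.cf_space_axioms T X.rounded[OF x]])
  then show "map_of_rel L \<kappa> M \<mu> \<Theta> x \<in> carrier M" "\<mu> (map_of_rel L \<kappa> M \<mu> \<Theta> x) = \<Theta> `` \<kappa> x"
    using x bij_betw_apply[OF bij_betw_inv_into[OF Y.bij]] bij_betw_inv_into_right[OF Y.bij]
    by (simp_all add: map_of_rel_def)
qed

text \<open>The image under a relation commutes with unions, and directed suprema are
  unions.\<close>

lemma map_of_rel_scott: "scott_continuous L M (map_of_rel L \<kappa> M \<mu> \<Theta>)"
  unfolding scott_continuous_def
proof (intro conjI allI impI)
  show "map_of_rel L \<kappa> M \<mu> \<Theta> \<in> carrier L \<rightarrow> carrier M" using map_of_rel(1) by blast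
  fix D s assume D: "directed L D \<and> is_lub L s D"
  then have s: "s \<in> carrier L" "\<kappa> s = (\<Union>d\<in>D. \<kappa> d)" using X.is_lub_directed_iff[of D s] by simp_all
  have DL: "D \<subseteq> carrier L" using D by (simp add: directed_def)
  show "is_lub M (map_of_rel L \<kappa> M \<mu> \<Theta> s) (map_of_rel L \<kappa> M \<mu> \<Theta> ` D)"
  proof (rule Y.is_lub_Union)
    show "map_of_rel L \<kappa> M \<mu> \<Theta> ` D \<subseteq> carrier M" using DL map_of_rel(1) by auto
    show "map_of_rel L \<kappa> M \<mu> \<Theta> s \<in> carrier M" using s(1) by (rule map_of_rel)
    have "(\<Union>d\<in>D. \<mu> (map_of_rel L \<kappa> M \<mu> \<Theta> d)) = (\<Union>d\<in>D. \<Theta> `` \<kappa> d)"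
      using DL by (intro SUP_cong refl map_of_rel(2)) auto
    also have "\<dots> = \<Theta> `` \<kappa> s" unfolding s(2) by blast
    finally show "\<mu> (map_of_rel L \<kappa> M \<mu> \<Theta> s) = (\<Union>d\<in>map_of_rel L \<kappa> M \<mu> \<Theta> ` D. \<mu> d)"
      using map_of_rel(2)[OF s(1)] by simp
  qed
qed

end

end

section \<open>Equivalence of the categories\<close>

lemma (in ideal_completion) approximable_eqI_elements:
  assumes "CF_approximable X Y \<Theta>" "CF_approximable X Y \<Theta>'"
    and "\<And>x. x \<in> carrier L \<Longrightarrow> \<Theta> `` \<kappa> x = \<Theta>' `` \<kappa> x"
  shows "\<Theta> = \<Theta>'"
  using cf_space_axioms assms(1,2)
proof (rule approximable_eqI)
  fix I assume "I \<in> rounded_ideals X"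
  from element[OF this] obtain x where "x \<in> carrier L" "\<kappa> x = I" by blast
  with assms(3)[of x] show "\<Theta> `` I = \<Theta>' `` I" by simp
qed

lemma APPS_simps:
  "objs (APPS P s) = {X. P X \<and> s (points X)}"
  "homs (APPS P s) X Y = {\<Theta>. CF_approximable X Y \<Theta>}"
  "ident (APPS P s) X = id_rel X"
  "compos (APPS P s) X Y Z \<Upsilon> \<Theta> = \<Theta> O \<Upsilon>"
  by (simp_all add: APPS_def id_rel_def)

lemma DOM_simps:
  "objs (DOM Q s) = {L. Q L \<and> s (carrier L)}"
  "homs (DOM Q s) L M = {f \<in> extensional (carrier L). scott_continuous L M f}"
  "ident (DOM Q s) L = restrict (\<lambda>x. x) (carrier L)"
  "compos (DOM Q s) L M N g f = compose (carrier L) g f"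
  by (simp_all add: DOM_def)

lemma id_rel_relcomp:
  assumes "CF_space X" and T: "CF_approximable X Y \<Theta>"
  shows "id_rel X O \<Theta> = \<Theta>"
proof -
  interpret cf_space X using assms(1) by unfold_locales
  show ?thesis
    using cf_space_axioms relcomp_approximable[OF id_rel_approximable T] T
    by (rule approximable_eqI) (simp add: relcomp_Image id_rel_Image)
qed

lemma relcomp_id_rel:
  assumes "CF_space X" "CF_space Y" and T: "CF_approximable X Y \<Theta>"
  shows "\<Theta> O id_rel Y = \<Theta>"
proof -
  interpret X: cf_space X using assms(1) by unfold_locales
  interpret Y: cf_space Y using assms(2) by unfold_locales
  show ?thesis
    using X.cf_space_axioms relcomp_approximable[OF T Y.id_rel_approximable] T
    by (rule approximable_eqI)
      (simp add: relcomp_Image Y.id_rel_Image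
        approximable_Image_rounded[OF X.cf_space_axioms Y.cf_space_axioms T])
qed

lemma category_APPS:
  assumes "\<And>X. P X \<Longrightarrow> CF_space X"
  shows "category (APPS P s)"
  unfolding category_def APPS_simps mem_Collect_eq
proof (intro conjI ballI; (elim CollectE conjE)?)
  show "CF_approximable X X (id_rel X)" if "P X" for X
    using assms[OF that] by (intro cf_space.id_rel_approximable cf_space.intro)
  show "CF_approximable X Z (\<Theta> O \<Upsilon>)"
    if "CF_approximable X Y \<Theta>" "CF_approximable Y Z \<Upsilon>" for X Y Z \<Theta> \<Upsilon>
    using that by (rule relcomp_approximable)
  show "id_rel X O \<Theta> = \<Theta>" if "P X" "CF_approximable X Y \<Theta>" for X Y \<Theta>
    using assms[OF that(1)] that(2) by (rule id_rel_relcomp)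
  show "\<Theta> O id_rel Y = \<Theta>" if "P X" "P Y" "CF_approximable X Y \<Theta>" for X Y \<Theta>
    using assms[OF that(1)] assms[OF that(2)] that(3) by (rule relcomp_id_rel)
qed (rule O_assoc[symmetric])

lemma scott_continuous_cong:
  assumes "\<And>x. x \<in> carrier L \<Longrightarrow> f x = g x"
  shows "scott_continuous L M f \<longleftrightarrow> scott_continuous L M g"
proof -
  have "(directed L D \<and> is_lub L s D \<longrightarrow> is_lub M (f s) (f ` D)) \<longleftrightarrow>
      (directed L D \<and> is_lub L s D \<longrightarrow> is_lub M (g s) (g ` D))" for D s
  proof (intro imp_cong refl)
    assume "directed L D \<and> is_lub L s D"
    then have D: "D \<subseteq> carrier L" and s: "s \<in> carrier L" by (auto simp: directed_def least_def Upper_def)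
    have "f ` D = g ` D" using assms D by (intro image_cong) auto
    with assms[OF s] show "is_lub M (f s) (f ` D) \<longleftrightarrow> is_lub M (g s) (g ` D)" by simp
  qed
  moreover have "f \<in> carrier L \<rightarrow> carrier M \<longleftrightarrow> g \<in> carrier L \<rightarrow> carrier M"
    using assms by (simp add: Pi_iff)
  ultimately show ?thesis by (simp add: scott_continuous_def)
qed

lemma scott_continuous_id: "scott_continuous L L (\<lambda>x. x)"
  by (simp add: scott_continuous_def)

lemma scott_continuous_comp:
  assumes L: "partial_order L" and f: "scott_continuous L M f" and g: "scott_continuous M N g"
  shows "scott_continuous L N (\<lambda>x. g (f x))"
  unfolding scott_continuous_def
proof (intro conjI allI impI)
  have fc: "f \<in> carrier L \<rightarrow> carrier M" and gc: "g \<in> carrier M \<rightarrow> carrier N"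
    using f g by (simp_all add: scott_continuous_def)
  then show "(\<lambda>x. g (f x)) \<in> carrier L \<rightarrow> carrier N" by (simp add: Pi_iff)
  fix D s assume D: "directed L D \<and> is_lub L s D"
  then have "directed M (f ` D)"
    using directed_image[OF _ fc scott_continuous_mono[OF L f]] by simp
  moreover have "is_lub M (f s) (f ` D)" using f D by (simp add: scott_continuous_def)
  ultimately have "is_lub N (g (f s)) (g ` f ` D)" using g by (simp add: scott_continuous_def)
  then show "is_lub N (g (f s)) ((\<lambda>x. g (f x)) ` D)" by (simp add: image_image)
qed

lemma scott_continuous_compose:
  assumes "partial_order L" "scott_continuous L M f" "scott_continuous M N g"
  shows "scott_continuous L N (compose (carrier L) g f)"
  using scott_continuous_comp[OF assms] by (subst scott_continuous_cong) (simp_all add: compose_eq)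

lemma category_DOM:
  assumes "\<And>L. Q L \<Longrightarrow> partial_order L"
  shows "category (DOM Q s)"
proof -
  have 1: "scott_continuous L L (restrict (\<lambda>x. x) (carrier L))" for L :: "'a gorder"
    using scott_continuous_id[of L] by (subst scott_continuous_cong) simp_all
  have 2: "f \<in> carrier L \<rightarrow> carrier M" if "scott_continuous L M f" for L M :: "'a gorder" and f
    using that by (simp add: scott_continuous_def)
  show ?thesis
    unfolding category_def DOM_simps
    using assms
    by (auto simp: 1 scott_continuous_compose Id_compose[OF 2] compose_Id[OF 2] compose_assoc[OF 2, symmetric])
qed

section \<open>The ideal completion encoded in the type of points\<close>

definition encode :: "'u space \<Rightarrow> 'u set set \<Rightarrow> 'u" where
  "encode X = (SOME h. inj_on h (rounded_ideals X))"

definition decode :: "'u space \<Rightarrow> 'u \<Rightarrow> 'u set set" where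
  "decode X = inv_into (rounded_ideals X) (encode X)"

definition completion :: "'u space \<Rightarrow> 'u gorder" where
  "completion X = \<lparr>carrier = encode X ` rounded_ideals X, eq = (=),
     le = (\<lambda>x y. decode X x \<subseteq> decode X y)\<rparr>"

text \<open>An injective encoding exists because an ideal is determined by its union, a set of
  points; this is the reason for the bound on the power set.\<close>

lemma ideal_completion_completion:
  fixes X :: "'u space"
  assumes X: "CF_space X" and small: "Pow (points X) \<lesssim> (UNIV :: 'u set)"
  shows "ideal_completion X (completion X) (decode X)"
proof -
  interpret cf_space X using X by unfold_locales
  have "rounded_ideals X \<lesssim> (UNIV :: 'u set)" using rounded_ideals_lepoll small by (rule lepoll_trans)
  then have "\<exists>h :: 'u set set \<Rightarrow> 'u. inj_on h (rounded_ideals X)" by (auto simp: lepoll_def)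
  then have inj: "inj_on (encode X) (rounded_ideals X)" unfolding encode_def by (rule someI_ex)
  show ?thesis
  proof
    show "bij_betw (decode X) (carrier (completion X)) (rounded_ideals X)"
      using bij_betw_inv_into[OF inj_on_imp_bij_betw[OF inj]]
      by (simp add: decode_def completion_def)
  qed (simp_all add: completion_def)
qed

lemma completion_lepoll: "CF_space X \<Longrightarrow> carrier (completion X) \<lesssim> Pow (points X)"
  using lepoll_trans[OF image_lepoll cf_space.rounded_ideals_lepoll[OF cf_space.intro]]
  by (simp add: completion_def)

text \<open>Two spaces with a common ideal completion are isomorphic: the identity of
  \<open>L\<close>, read as a relation in both directions, gives mutually inverse arrows.\<close>

lemma rel_of_map_id_inverse:
  assumes "ideal_completions X L \<kappa> Y L \<mu>"
  shows "rel_of_map X L \<kappa> \<mu> (\<lambda>x. x) O rel_of_map Y L \<mu> \<kappa> (\<lambda>x. x) = id_rel X"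
proof -
  interpret XY: ideal_completions X L \<kappa> Y L \<mu> by fact
  interpret YX: ideal_completions Y L \<mu> X L \<kappa> by unfold_locales
  have id: "scott_continuous L L (\<lambda>x. x)" by (rule scott_continuous_id)
  show ?thesis
  proof (rule XY.X.approximable_eqI_elements)
    show "CF_approximable X X (rel_of_map X L \<kappa> \<mu> (\<lambda>x. x) O rel_of_map Y L \<mu> \<kappa> (\<lambda>x. x))"
      using XY.rel_of_map_approximable[OF id] YX.rel_of_map_approximable[OF id]
      by (rule relcomp_approximable)
    show "CF_approximable X X (id_rel X)" by (rule XY.X.id_rel_approximable)
    fix x assume x: "x \<in> carrier L"
    then show "(rel_of_map X L \<kappa> \<mu> (\<lambda>x. x) O rel_of_map Y L \<mu> \<kappa> (\<lambda>x. x)) `` \<kappa> x = id_rel X `` \<kappa> x"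
      by (simp add: relcomp_Image XY.rel_of_map_Image[OF id] YX.rel_of_map_Image[OF id]
          XY.X.id_rel_Image XY.X.rounded)
  qed
qed

text \<open>Dually, two ideal completions of one space are isomorphic through the maps induced by
  its identity relation.\<close>

lemma map_of_id_rel_inverse:
  assumes "ideal_completions X L \<kappa> X M \<mu>"
  shows "compose (carrier L) (map_of_rel M \<mu> L \<kappa> (id_rel X)) (map_of_rel L \<kappa> M \<mu> (id_rel X)) =
    restrict (\<lambda>x. x) (carrier L)"
proof -
  interpret A: ideal_completions X L \<kappa> X M \<mu> by fact
  interpret B: ideal_completions X M \<mu> X L \<kappa> by unfold_locales
  note id = A.X.id_rel_approximable
  have "map_of_rel M \<mu> L \<kappa> (id_rel X) (map_of_rel L \<kappa> M \<mu> (id_rel X) x) = x" if x: "x \<in> carrier L" for x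
  proof -
    note y = A.map_of_rel[OF id x]
    have "\<kappa> (map_of_rel M \<mu> L \<kappa> (id_rel X) (map_of_rel L \<kappa> M \<mu> (id_rel X) x)) = \<kappa> x"
      using B.map_of_rel(2)[OF id y(1)] y(2) x by (simp add: A.X.id_rel_Image A.X.rounded)
    then show ?thesis using A.X.kappa_eq_iff[OF B.map_of_rel(1)[OF id y(1)] x] by simp
  qed
  then show ?thesis by (auto simp: compose_def restrict_def)
qed

section \<open>The two functors and the natural isomorphisms\<close>

lemma power_stepD:
  assumes "power_step s t" "s (A :: 'u set)"
  shows "Pow A \<lesssim> (UNIV :: 'u set)" "B \<lesssim> Pow A \<Longrightarrow> t B"
  using assms by (simp_all add: power_step_def)

text \<open>The assumptions isolate what varies among the five equivalences; \<open>Bs\<close>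
  selects the basis from which the space of a domain is built.\<close>

locale apps_dom =
  fixes P :: "'u space \<Rightarrow> bool" and Q :: "'u gorder \<Rightarrow> bool" and Bs :: "'u gorder \<Rightarrow> 'u set"
  assumes P_CF: "P X \<Longrightarrow> CF_space X"
    and Q_based: "Q L \<Longrightarrow> based_domain L (Bs L)"
    and P_Q: "\<lbrakk>P X; ideal_completion X L \<kappa>\<rbrakk> \<Longrightarrow> Q L"
    and Q_P: "Q L \<Longrightarrow> P (basis_space L (Bs L))"
begin

abbreviation "F \<equiv> completion"

abbreviation "Fa X Y \<equiv> map_of_rel (F X) (decode X) (F Y) (decode Y)"

abbreviation "G L \<equiv> basis_space L (Bs L)"

abbreviation "appr L \<equiv> approximants L (Bs L)"

abbreviation "Ga L M \<equiv> rel_of_map (G L) L (appr L) (appr M)"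

lemma completion_G: "Q L \<Longrightarrow> ideal_completion (G L) L (appr L)"
  by (rule based_domain.ideal_completion_S[OF Q_based])

lemma completion_F:
  assumes "power_step s t" "P X" "s (points X)"
  shows "ideal_completion X (F X) (decode X)"
  using P_CF assms power_stepD(1) by (blast intro: ideal_completion_completion)

lemma Q_partial_order: "Q L \<Longrightarrow> partial_order L"
  using Q_based by (simp add: based_domain_def dcpo_def)

lemma F_objs:
  assumes "power_step s t" "P X" "s (points X)"
  shows "Q (F X)" "t (carrier (F X))"
  using P_Q[OF assms(2) completion_F[OF assms]]
    power_stepD(2)[OF assms(1,3) completion_lepoll[OF P_CF[OF assms(2)]]] by simp_all

lemma G_objs:
  assumes "power_step s t" "Q L" "s (carrier L)"
  shows "P (G L)" "t (points (G L))"
proof -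
  interpret based_domain L "Bs L" using assms(2) by (rule Q_based)
  show "P (G L)" using assms(2) by (rule Q_P)
  have "Bs L \<lesssim> Pow (carrier L)"
    using subset_imp_lepoll[OF B_carrier] lepoll_Pow_self by (rule lepoll_trans)
  then show "t (points (G L))" using power_stepD(2)[OF assms(1,3)] by (simp add: S_simps)
qed

lemma F_pair:
  assumes "power_step s t" "P X" "s (points X)" "P Y" "s (points Y)"
  shows "ideal_completions X (F X) (decode X) Y (F Y) (decode Y)"
  using completion_F assms by (simp add: ideal_completions_def)

lemma G_pair:
  assumes "Q L" "Q M"
  shows "ideal_completions (G L) L (appr L) (G M) M (appr M)"
  using completion_G assms by (simp add: ideal_completions_def)

lemma map_of_rel_extensional: "map_of_rel L \<kappa> M \<mu> \<Theta> \<in> extensional (carrier L)"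
  by (simp add: map_of_rel_def)

text \<open>Equations between maps are checked after \<open>decode\<close>, where \<open>Fa\<close>
  acts as taking images under the relation, so composition becomes
  \<open>relcomp_Image\<close>.\<close>

lemma functor_F:
  assumes st: "power_step s t"
  shows "is_functor (APPS P s) (DOM Q t) F Fa"
  unfolding is_functor_def APPS_simps DOM_simps mem_Collect_eq
proof (intro conjI ballI; (elim CollectE conjE)?)
  fix X assume X: "P X" "s (points X)"
  show "Q (F X)" "t (carrier (F X))" using F_objs[OF st X] .
  interpret ideal_completions X "F X" "decode X" X "F X" "decode X" by (rule F_pair[OF st X X])
  show "Fa X X (id_rel X) = restrict (\<lambda>x. x) (carrier (F X))"
  proof (rule extensionalityI[OF map_of_rel_extensional])
    fix x assume x: "x \<in> carrier (F X)"
    note y = map_of_rel[OF X.id_rel_approximable x]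
    then have "Fa X X (id_rel X) x = x"
      using x X.kappa_eq_iff[OF y(1) x] by (simp add: X.id_rel_Image X.rounded)
    with x show "Fa X X (id_rel X) x = restrict (\<lambda>x. x) (carrier (F X)) x" by simp
  qed simp
next
  fix X Y \<Theta> assume X: "P X" "s (points X)" and Y: "P Y" "s (points Y)" and T: "CF_approximable X Y \<Theta>"
  interpret ideal_completions X "F X" "decode X" Y "F Y" "decode Y" by (rule F_pair[OF st X Y])
  show "Fa X Y \<Theta> \<in> extensional (carrier (F X))" by (rule map_of_rel_extensional)
  show "scott_continuous (F X) (F Y) (Fa X Y \<Theta>)" using T by (rule map_of_rel_scott)
next
  fix X Y Z \<Theta> \<Upsilon> assume X: "P X" "s (points X)" and Y: "P Y" "s (points Y)" and Z: "P Z" "s (points Z)"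
    and T: "CF_approximable X Y \<Theta>" and V: "CF_approximable Y Z \<Upsilon>"
  interpret XY: ideal_completions X "F X" "decode X" Y "F Y" "decode Y" by (rule F_pair[OF st X Y])
  interpret YZ: ideal_completions Y "F Y" "decode Y" Z "F Z" "decode Z" by (rule F_pair[OF st Y Z])
  interpret XZ: ideal_completions X "F X" "decode X" Z "F Z" "decode Z" by (rule F_pair[OF st X Z])
  show "Fa X Z (\<Theta> O \<Upsilon>) = compose (carrier (F X)) (Fa Y Z \<Upsilon>) (Fa X Y \<Theta>)"
  proof (rule extensionalityI[OF map_of_rel_extensional])
    fix x assume x: "x \<in> carrier (F X)"
    note y = XY.map_of_rel[OF T x]
    note z = YZ.map_of_rel[OF V y(1)]
    note w = XZ.map_of_rel[OF relcomp_approximable[OF T V] x]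
    have "Fa X Z (\<Theta> O \<Upsilon>) x = Fa Y Z \<Upsilon> (Fa X Y \<Theta> x)"
      using YZ.Y.kappa_eq_iff[OF w(1) z(1)] y(2) z(2) w(2) by (simp add: relcomp_Image)
    with x show "Fa X Z (\<Theta> O \<Upsilon>) x = compose (carrier (F X)) (Fa Y Z \<Upsilon>) (Fa X Y \<Theta>) x"
      by (simp add: compose_eq)
  qed simp
qed

text \<open>Equations between relations are checked on the ideals \<open>appr L x\<close>, on which
  \<open>Ga L M f\<close> acts as \<open>f\<close>.\<close>

lemma functor_G:
  assumes st: "power_step s t"
  shows "is_functor (DOM Q s) (APPS P t) G Ga"
  unfolding is_functor_def APPS_simps DOM_simps mem_Collect_eq
proof (intro conjI ballI; (elim CollectE conjE)?)
  fix L assume L: "Q L" "s (carrier L)"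
  show "P (G L)" "t (points (G L))" using G_objs[OF st L] .
  interpret ideal_completions "G L" L "appr L" "G L" L "appr L" by (rule G_pair[OF L(1) L(1)])
  have id: "scott_continuous L L (restrict (\<lambda>x. x) (carrier L))"
    using scott_continuous_id[of L] by (subst scott_continuous_cong) simp_all
  show "Ga L L (restrict (\<lambda>x. x) (carrier L)) = id_rel (G L)"
  proof (rule X.approximable_eqI_elements)
    show "CF_approximable (G L) (G L) (Ga L L (restrict (\<lambda>x. x) (carrier L)))"
      using id by (rule rel_of_map_approximable)
    show "CF_approximable (G L) (G L) (id_rel (G L))" by (rule X.id_rel_approximable)
    fix x assume "x \<in> carrier L"
    then show "Ga L L (restrict (\<lambda>x. x) (carrier L)) `` appr L x = id_rel (G L) `` appr L x"
      by (simp add: rel_of_map_Image[OF id] X.id_rel_Image X.rounded)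
  qed
next
  fix L M f assume L: "Q L" and M: "Q M" and f: "scott_continuous L M f"
  interpret ideal_completions "G L" L "appr L" "G M" M "appr M" by (rule G_pair[OF L M])
  show "CF_approximable (G L) (G M) (Ga L M f)" using f by (rule rel_of_map_approximable)
next
  fix L M N f g assume L: "Q L" and M: "Q M" and N: "Q N"
    and f: "scott_continuous L M f" and g: "scott_continuous M N g"
  interpret LM: ideal_completions "G L" L "appr L" "G M" M "appr M" by (rule G_pair[OF L M])
  interpret MN: ideal_completions "G M" M "appr M" "G N" N "appr N" by (rule G_pair[OF M N])
  interpret LN: ideal_completions "G L" L "appr L" "G N" N "appr N" by (rule G_pair[OF L N])
  note gf = scott_continuous_compose[OF LM.X.partial_order_axioms f g]
  show "Ga L N (compose (carrier L) g f) = Ga L M f O Ga M N g"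
  proof (rule LM.X.approximable_eqI_elements)
    show "CF_approximable (G L) (G N) (Ga L N (compose (carrier L) g f))"
      using gf by (rule LN.rel_of_map_approximable)
    show "CF_approximable (G L) (G N) (Ga L M f O Ga M N g)"
      using LM.rel_of_map_approximable[OF f] MN.rel_of_map_approximable[OF g]
      by (rule relcomp_approximable)
    fix x assume x: "x \<in> carrier L"
    then show "Ga L N (compose (carrier L) g f) `` appr L x = (Ga L M f O Ga M N g) `` appr L x"
      using LM.f_carrier[OF f x]
      by (simp add: relcomp_Image LN.rel_of_map_Image[OF gf] LM.rel_of_map_Image[OF f]
          MN.rel_of_map_Image[OF g] compose_eq)
  qed
qed

text \<open>\<open>X\<close> and \<open>G (F X)\<close> share the ideal completion
  \<open>F X\<close>, whose identity gives the component at \<open>X\<close>. In the naturality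
  square both sides send \<open>appr (F X) x\<close> to the image of \<open>decode X x\<close> under
  \<open>\<Theta>\<close>.\<close>

lemma naturally_isomorphic_GF:
  assumes st: "power_step s t"
  shows "naturally_isomorphic (APPS P s) (APPS P u)
    (\<lambda>X. G (F X)) (\<lambda>X Y \<Theta>. Ga (F X) (F Y) (Fa X Y \<Theta>)) (\<lambda>X. X) (\<lambda>X Y \<Theta>. \<Theta>)"
proof -
  define \<eta> where "\<eta> X = rel_of_map (G (F X)) (F X) (appr (F X)) (decode X) (\<lambda>x. x)" for X
  have pair: "ideal_completions (G (F X)) (F X) (appr (F X)) X (F X) (decode X)"
    if "P X" "s (points X)" for X
    using completion_F[OF st that] completion_G[OF F_objs(1)[OF st that]]
    by (simp add: ideal_completions_def)
  show ?thesis
    unfolding naturally_isomorphic_def iso_arrow_def APPS_simps mem_Collect_eq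
  proof (intro exI[of _ \<eta>] conjI ballI; (elim CollectE conjE)?)
    fix X assume X: "P X" "s (points X)"
    interpret A: ideal_completions "G (F X)" "F X" "appr (F X)" X "F X" "decode X"
      by (rule pair[OF X])
    interpret B: ideal_completions X "F X" "decode X" "G (F X)" "F X" "appr (F X)"
      by unfold_locales
    show "CF_approximable (G (F X)) X (\<eta> X)"
      unfolding \<eta>_def by (rule A.rel_of_map_approximable[OF scott_continuous_id])
    show "\<exists>g\<in>{\<Theta>. CF_approximable X (G (F X)) \<Theta>}. \<eta> X O g = id_rel (G (F X)) \<and> g O \<eta> X = id_rel X"
      unfolding \<eta>_def
      using B.rel_of_map_approximable[OF scott_continuous_id]
        rel_of_map_id_inverse[OF A.ideal_completions_axioms]
        rel_of_map_id_inverse[OF B.ideal_completions_axioms] by blast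
  next
    fix X Y \<Theta> assume X: "P X" "s (points X)" and Y: "P Y" "s (points Y)" and T: "CF_approximable X Y \<Theta>"
    interpret A: ideal_completions "G (F X)" "F X" "appr (F X)" X "F X" "decode X"
      by (rule pair[OF X])
    interpret B: ideal_completions "G (F Y)" "F Y" "appr (F Y)" Y "F Y" "decode Y"
      by (rule pair[OF Y])
    interpret C: ideal_completions X "F X" "decode X" Y "F Y" "decode Y" by (rule F_pair[OF st X Y])
    interpret D: ideal_completions "G (F X)" "F X" "appr (F X)" "G (F Y)" "F Y" "appr (F Y)"
      by unfold_locales
    note Tf = C.map_of_rel_scott[OF T]
    have \<eta>: "CF_approximable (G (F X)) X (\<eta> X)" "CF_approximable (G (F Y)) Y (\<eta> Y)"
      "\<And>x. x \<in> carrier (F X) \<Longrightarrow> \<eta> X `` appr (F X) x = decode X x"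
      "\<And>y. y \<in> carrier (F Y) \<Longrightarrow> \<eta> Y `` appr (F Y) y = decode Y y"
      unfolding \<eta>_def
      using A.rel_of_map_approximable[OF scott_continuous_id] A.rel_of_map_Image[OF scott_continuous_id]
        B.rel_of_map_approximable[OF scott_continuous_id] B.rel_of_map_Image[OF scott_continuous_id]
      by blast+
    show "Ga (F X) (F Y) (Fa X Y \<Theta>) O \<eta> Y = \<eta> X O \<Theta>"
    proof (rule A.X.approximable_eqI_elements)
      show "CF_approximable (G (F X)) Y (Ga (F X) (F Y) (Fa X Y \<Theta>) O \<eta> Y)"
        using D.rel_of_map_approximable[OF Tf] \<eta>(2) by (rule relcomp_approximable)
      show "CF_approximable (G (F X)) Y (\<eta> X O \<Theta>)" using \<eta>(1) T by (rule relcomp_approximable)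
      fix x assume x: "x \<in> carrier (F X)"
      then show "(Ga (F X) (F Y) (Fa X Y \<Theta>) O \<eta> Y) `` appr (F X) x = (\<eta> X O \<Theta>) `` appr (F X) x"
        using C.map_of_rel[OF T x]
        by (simp add: relcomp_Image D.rel_of_map_Image[OF Tf] \<eta>(3,4))
    qed
  qed
qed

lemma naturally_isomorphic_FG:
  assumes st: "power_step s t" and tu: "power_step t u"
  shows "naturally_isomorphic (DOM Q s) (DOM Q u)
    (\<lambda>L. F (G L)) (\<lambda>L M f. Fa (G L) (G M) (Ga L M f)) (\<lambda>L. L) (\<lambda>L M f. f)"
proof -
  define \<epsilon> where "\<epsilon> L = map_of_rel (F (G L)) (decode (G L)) L (appr L) (id_rel (G L))" for L
  have pair: "ideal_completions (G L) (F (G L)) (decode (G L)) (G L) L (appr L)"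
    if "Q L" "s (carrier L)" for L
    \<comment> \<open>The space \<open>G L\<close> is only known to be \<open>t\<close>-small, so
      encoding its ideals takes the second power step.\<close>
    using completion_F[OF tu G_objs[OF st that]] completion_G[OF that(1)]
    by (simp add: ideal_completions_def)
  show ?thesis
    unfolding naturally_isomorphic_def iso_arrow_def DOM_simps mem_Collect_eq
  proof (intro exI[of _ \<epsilon>] conjI ballI; (elim CollectE conjE)?)
    fix L assume L: "Q L" "s (carrier L)"
    interpret A: ideal_completions "G L" "F (G L)" "decode (G L)" "G L" L "appr L"
      by (rule pair[OF L])
    interpret B: ideal_completions "G L" L "appr L" "G L" "F (G L)" "decode (G L)"
      by unfold_locales
    show "\<epsilon> L \<in> extensional (carrier (F (G L)))"
      unfolding \<epsilon>_def by (rule map_of_rel_extensional)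
    show "scott_continuous (F (G L)) L (\<epsilon> L)"
      unfolding \<epsilon>_def by (rule A.map_of_rel_scott[OF A.X.id_rel_approximable])
    show "\<exists>g\<in>{f \<in> extensional (carrier L). scott_continuous L (F (G L)) f}.
        compose (carrier (F (G L))) g (\<epsilon> L) = restrict (\<lambda>x. x) (carrier (F (G L))) \<and>
        compose (carrier L) (\<epsilon> L) g = restrict (\<lambda>x. x) (carrier L)"
      unfolding \<epsilon>_def
    proof (intro bexI conjI CollectI)
      show "compose (carrier (F (G L))) (map_of_rel L (appr L) (F (G L)) (decode (G L)) (id_rel (G L)))
          (map_of_rel (F (G L)) (decode (G L)) L (appr L) (id_rel (G L))) = restrict (\<lambda>x. x) (carrier (F (G L)))"
        by (rule map_of_id_rel_inverse[OF A.ideal_completions_axioms])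
      show "compose (carrier L) (map_of_rel (F (G L)) (decode (G L)) L (appr L) (id_rel (G L)))
          (map_of_rel L (appr L) (F (G L)) (decode (G L)) (id_rel (G L))) = restrict (\<lambda>x. x) (carrier L)"
        by (rule map_of_id_rel_inverse[OF B.ideal_completions_axioms])
    qed (rule map_of_rel_extensional B.map_of_rel_scott[OF A.X.id_rel_approximable])+
  next
    fix L M f assume L: "Q L" "s (carrier L)" and M: "Q M" "s (carrier M)"
      and f: "scott_continuous L M f"
    interpret A: ideal_completions "G L" "F (G L)" "decode (G L)" "G L" L "appr L"
      by (rule pair[OF L])
    interpret B: ideal_completions "G M" "F (G M)" "decode (G M)" "G M" M "appr M"
      by (rule pair[OF M])
    interpret C: ideal_completions "G L" L "appr L" "G M" M "appr M" by (rule G_pair[OF L(1) M(1)])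
    interpret D: ideal_completions "G L" "F (G L)" "decode (G L)" "G M" "F (G M)" "decode (G M)"
      by unfold_locales
    note R = C.rel_of_map_approximable[OF f]
    show "compose (carrier (F (G L))) (\<epsilon> M) (Fa (G L) (G M) (Ga L M f)) =
        compose (carrier (F (G L))) f (\<epsilon> L)"
    proof (rule extensionalityI[OF compose_extensional compose_extensional])
      fix z assume z: "z \<in> carrier (F (G L))"
      note x = A.map_of_rel[OF A.X.id_rel_approximable z, folded \<epsilon>_def]
      note w = D.map_of_rel[OF R z]
      note v = B.map_of_rel[OF B.X.id_rel_approximable w(1), folded \<epsilon>_def]
      \<comment> \<open>Naturality is checked on the ideals of \<open>G M\<close>; the identity
        relations inside both components act trivially there.\<close>
      have "appr M (\<epsilon> M (Fa (G L) (G M) (Ga L M f) z)) = Ga L M f `` decode (G L) z"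
        using v(2) w(2) B.X.id_rel_Image[OF B.X.rounded[OF w(1)]] by simp
      also have "\<dots> = Ga L M f `` appr L (\<epsilon> L z)"
        using x(2) z by (simp add: A.X.id_rel_Image A.X.rounded)
      also have "\<dots> = appr M (f (\<epsilon> L z))" using x(1) by (rule C.rel_of_map_Image[OF f])
      finally have "\<epsilon> M (Fa (G L) (G M) (Ga L M f) z) = f (\<epsilon> L z)"
        using B.Y.kappa_eq_iff[OF v(1) C.f_carrier[OF f x(1)]] by simp
      with z show "compose (carrier (F (G L))) (\<epsilon> M) (Fa (G L) (G M) (Ga L M f)) z =
          compose (carrier (F (G L))) f (\<epsilon> L) z" by (simp add: compose_eq)
    qed
  qed
qed

theorem equivalent_across_sizes_APPS_DOM: "equivalent_across_sizes (APPS P) (DOM Q)"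
  unfolding equivalent_across_sizes_def
proof (intro conjI allI exI[of _ F] exI[of _ Fa] exI[of _ G] exI[of _ Ga] impI)
  show "category (APPS P s)" for s using P_CF by (rule category_APPS)
  show "category (DOM Q s)" for s using Q_partial_order by (rule category_DOM)
  fix s t u :: "'u set \<Rightarrow> bool" assume "power_step s t \<and> power_step t u"
  then have st: "power_step s t" and tu: "power_step t u" by simp_all
  show "is_functor (APPS P s) (DOM Q t) F Fa" using st by (rule functor_F)
  show "is_functor (DOM Q s) (APPS P t) G Ga" using st by (rule functor_G)
  show "naturally_isomorphic (APPS P s) (APPS P u)
    (\<lambda>X. G (F X)) (\<lambda>X Y f. Ga (F X) (F Y) (Fa X Y f)) (\<lambda>X. X) (\<lambda>X Y f. f)"
    using st by (rule naturally_isomorphic_GF)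
  show "naturally_isomorphic (DOM Q s) (DOM Q u)
    (\<lambda>X. F (G X)) (\<lambda>X Y f. Fa (G X) (G Y) (Ga X Y f)) (\<lambda>X. X) (\<lambda>X Y f. f)"
    using st tu by (rule naturally_isomorphic_FG)
qed

end

lemma equivalent_categories_universe:
  assumes "equivalent_across_sizes C D" "universe small"
  shows "equivalent_categories (C small) (D small)"
  using assms unfolding equivalent_across_sizes_def equivalent_categories_def universe_def by blast

section \<open>The five pairs of categories as instances\<close>

lemma apps_dom_sL: "apps_dom (sL_space :: 'u space \<Rightarrow> bool) sL_domain carrier"
proof (rule apps_dom.intro)
  fix L :: "'u gorder" assume L: "sL_domain L"
  then show based: "based_domain L (carrier L)"
    by (simp add: sL_domain_def continuous_domain_based)
  show "sL_space (basis_space L (carrier L))"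
    by (rule based_domain.sL_space_S[OF based _ L]) simp
qed (simp_all add: sL_space_imp_CF_space ideal_completion.sL_domain_L)

lemma apps_dom_L: "apps_dom (L_space :: 'u space \<Rightarrow> bool) L_domain carrier"
proof (rule apps_dom.intro)
  fix L :: "'u gorder" assume L: "L_domain L"
  then show based: "based_domain L (carrier L)"
    by (simp add: L_domain_def continuous_domain_based)
  show "L_space (basis_space L (carrier L))"
    by (rule based_domain.L_space_S[OF based _ L]) simp
qed (simp_all add: L_space_imp_CF_space ideal_completion.L_domain_L)

lemma apps_dom_bc: "apps_dom (bc_space :: 'u space \<Rightarrow> bool) bc_domain carrier"
proof (rule apps_dom.intro)
  fix L :: "'u gorder" assume L: "bc_domain L"
  then show based: "based_domain L (carrier L)"
    by (simp add: bc_domain_def continuous_domain_based)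
  show "bc_space (basis_space L (carrier L))"
    by (rule based_domain.bc_space_S[OF based refl L])
qed (simp_all add: bc_space_imp_CF_space ideal_completion.bc_domain_L)

lemma apps_dom_TopsL:
  "apps_dom (\<lambda>X :: 'u space. sL_space X \<and> topological X) (\<lambda>L. sL_domain L \<and> algebraic_domain L) compacts"
proof (rule apps_dom.intro)
  fix L :: "'u gorder" assume L: "sL_domain L \<and> algebraic_domain L"
  then show based: "based_domain L (compacts L)"
    by (simp add: sL_domain_def algebraic_domain_based)
  show "sL_space (basis_space L (compacts L)) \<and> topological (basis_space L (compacts L))"
    using based_domain.sL_space_S[OF based] based_domain.topological_S[OF based] L by simp
qed (simp_all add: sL_space_imp_CF_space ideal_completion.sL_domain_L ideal_completion.algebraic_domain_L)

lemma apps_dom_TopL: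
  "apps_dom (\<lambda>X :: 'u space. L_space X \<and> topological X) (\<lambda>L. L_domain L \<and> algebraic_domain L) compacts"
proof (rule apps_dom.intro)
  fix L :: "'u gorder" assume L: "L_domain L \<and> algebraic_domain L"
  then show based: "based_domain L (compacts L)"
    by (simp add: L_domain_def algebraic_domain_based)
  show "L_space (basis_space L (compacts L)) \<and> topological (basis_space L (compacts L))"
    using based_domain.L_space_S[OF based] based_domain.topological_S[OF based] L by simp
qed (simp_all add: L_space_imp_CF_space ideal_completion.L_domain_L ideal_completion.algebraic_domain_L)

theorem theorem5p14:
  shows "(\<forall>small :: 'u set \<Rightarrow> bool. universe small \<longrightarrow>
            equivalent_categories (sL_APPS small) (sL_DOM small) \<and>
            equivalent_categories (L_APPS small) (L_DOM small) \<and>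
            equivalent_categories (bc_APPS small) (bc_DOM small) \<and>
            equivalent_categories (TopsL_APPS small) (AsL_DOM small) \<and>
            equivalent_categories (TopL_APPS small) (AL_DOM small)) \<and>
         equivalent_across_sizes (sL_APPS :: ('u set \<Rightarrow> bool) \<Rightarrow> _) sL_DOM \<and>
         equivalent_across_sizes (L_APPS :: ('u set \<Rightarrow> bool) \<Rightarrow> _) L_DOM \<and>
         equivalent_across_sizes (bc_APPS :: ('u set \<Rightarrow> bool) \<Rightarrow> _) bc_DOM \<and>
         equivalent_across_sizes (TopsL_APPS :: ('u set \<Rightarrow> bool) \<Rightarrow> _) AsL_DOM \<and>
         equivalent_across_sizes (TopL_APPS :: ('u set \<Rightarrow> bool) \<Rightarrow> _) AL_DOM"
proof -
  note eq = apps_dom.equivalent_across_sizes_APPS_DOM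
  have "equivalent_across_sizes (sL_APPS :: ('u set \<Rightarrow> bool) \<Rightarrow> _) sL_DOM"
    "equivalent_across_sizes (L_APPS :: ('u set \<Rightarrow> bool) \<Rightarrow> _) L_DOM"
    "equivalent_across_sizes (bc_APPS :: ('u set \<Rightarrow> bool) \<Rightarrow> _) bc_DOM"
    "equivalent_across_sizes (TopsL_APPS :: ('u set \<Rightarrow> bool) \<Rightarrow> _) AsL_DOM"
    "equivalent_across_sizes (TopL_APPS :: ('u set \<Rightarrow> bool) \<Rightarrow> _) AL_DOM"
    by (rule eq[OF apps_dom_sL] eq[OF apps_dom_L] eq[OF apps_dom_bc]
        eq[OF apps_dom_TopsL] eq[OF apps_dom_TopL])+
  then show ?thesis
    by (simp add: equivalent_categories_universe)
qed

end
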